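(* Let $d\in\mathbb N$, $r\ge 1$, $\boldsymbol\sigma=(\sigma_1,\dots,\sigma_d)$ with all $\sigma_\ell>0$, and let $f\in B^r_{\boldsymbol\sigma,d}$. For each $\ell=1,\dots,d$ let $\{t^{(\ell)}_{n}\}_{n\in\mathbb Z}$ be a real sequence which is separated in the sense that \[\inf_{n\neq m}|t^{(\ell)}_{n}-t^{(\ell)}_{m}|\ge \delta_\ell>0,\] and for $\mathbf n=(n_1,\dots,n_d)\in\mathbb Z^d$ put $t_{\mathbf n}=(t^{(1)}_{n_1},\dots,t^{(d)}_{n_d})$. Then \[\sum_{\mathbf n\in\mathbb Z^d}|f(t_{\mathbf n})|^r\le \mathfrak B_{d,r}\,\|f\|_r^r,\qquad \mathfrak B_{d,r}=\Big(\frac{8}{r\pi}\Big)^d\prod_{\ell=1}^d\frac{e^{r\delta_\ell\sigma_\ell/2}-1}{\sigma_\ell\delta_\ell^2}.\]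
   Context: $B^r_{\boldsymbol\sigma,d}$ (Bernstein class) denotes the class of entire functions of $d$ complex variables which are of exponential type at most $\sigma_\ell$ in the $\ell$-th variable (coordinatewise, $\ell=1,\dots,d$) and whose restriction to $\mathbb R^d$ belongs to $L^r(\mathbb R^d)$. $\|f\|_r$ denotes the $L^r(\mathbb R^d)$-norm of the restriction of $f$ to $\mathbb R^d$. *)

theory Defs
  imports "HOL-Analysis.Analysis"
begin

definition cvec_of :: "real ^ 'n \<Rightarrow> complex ^ 'n" where
  "cvec_of x = (\<chi> k. complex_of_real (x $ k))"

definition entire_fun :: "(complex ^ 'n \<Rightarrow> complex) \<Rightarrow> bool" where
  "entire_fun f \<longleftrightarrow> (\<forall>z. \<exists>L. (f has_derivative L) (at z) \<and>
       (\<forall>c w. L (c *s w) = c * L w))"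

definition exp_type_le :: "(complex ^ 'n \<Rightarrow> complex) \<Rightarrow> real ^ 'n \<Rightarrow> bool" where
  "exp_type_le f \<sigma> \<longleftrightarrow> (\<forall>\<epsilon>>0. \<exists>C. \<forall>z.
       norm (f z) \<le> C * exp (\<Sum>l\<in>UNIV. (\<sigma> $ l + \<epsilon>) * norm (z $ l)))"

definition Lr_on_reals :: "real \<Rightarrow> (complex ^ 'n \<Rightarrow> complex) \<Rightarrow> bool" where
  "Lr_on_reals r f \<longleftrightarrow> (\<lambda>x. f (cvec_of x)) \<in> borel_measurable lborel \<and>
       integrable lborel (\<lambda>x::real ^ 'n. norm (f (cvec_of x)) powr r)"

definition bernstein_class :: "real \<Rightarrow> real ^ 'n \<Rightarrow> (complex ^ 'n \<Rightarrow> complex) set" where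
  "bernstein_class r \<sigma> = {f. entire_fun f \<and> exp_type_le f \<sigma> \<and> Lr_on_reals r f}"

definition Lr_norm_pow :: "real \<Rightarrow> (complex ^ 'n \<Rightarrow> complex) \<Rightarrow> real" where
  "Lr_norm_pow r f = integral\<^sup>L (lborel :: (real ^ 'n) measure) (\<lambda>x. norm (f (cvec_of x)) powr r)"

end

theory Submission
  imports Defs "HOL-Complex_Analysis.Complex_Analysis" "HOL-Real_Asymp.Real_Asymp"
begin

unbundle no fps_syntax

text \<open>
  In one variable, |g|^r is dominated by its mean over discs. The discs of radius \<open>\<delta>/2\<close> around the
  points of the sequence are disjoint and lie in the strip |Im z| \<open>\<le>\<close> \<open>\<delta>/2\<close>, so the sampled sum is at most
  4/(\<open>\<pi>\<delta>\<close>^2) times the integral of |g|^r over the strip. The Plancherel-Polya inequality bounds the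
  integral over the line Im z = y by e^(r \<open>\<sigma>\<close> |y|) times the one over the real line, and integrating
  in y gives the constant. It is proved by duality: g is integrated against a compactly supported
  kernel chosen from its values on the line Im z = y; the result is entire, of the same exponential
  type and bounded on the real line, so the Phragmen-Lindeloef principle applies to it.

  For several variables, coordinates are switched from integration to summation one at a time.
  The one-variable inequality holds in \<open>[0, \<infinity>]\<close>, so no integrability of the sections is required.
\<close>

section \<open>The Phragmen-Lindeloef principle\<close>

text \<open>Exponential growth has order 1, below the order 2 that is critical for a right angle. A
  damping factor whose exponent has order 3/2, strictly between the two, has modulus at most 1 on
  the quadrant and makes the function small on large arcs. The maximum principle then applies, and
  the damping is removed in the limit.\<close>

lemma phragmen_lindelof_quadrant:
  fixes H :: "complex \<Rightarrow> complex"
  assumes H: "H holomorphic_on UNIV"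
    and growth: "\<And>z. norm (H z) \<le> C * exp (a * norm z)"
    and B: "B > 0"
    and re: "\<And>x. x \<ge> 0 \<Longrightarrow> norm (H (of_real x)) \<le> B"
    and im: "\<And>y. y \<ge> 0 \<Longrightarrow> norm (H (\<i> * of_real y)) \<le> B"
    and z: "Re z \<ge> 0" "Im z \<ge> 0"
  shows "norm (H z) \<le> B"
proof -
  define c where "c = cos (3 * pi / 8)"
  have c: "c > 0" unfolding c_def by (rule cos_gt_zero_pi) auto
  \<comment> \<open>A branch of the power 3/2 on the quadrant, rotated so that its values lie in a sector around
     the positive axis; the translation by 1 + i keeps the closed quadrant off the branch cut.\<close>
  define w where "w = (\<lambda>z. cis (- (3 * pi / 8)) * exp (3/2 * Ln (z + 1 + \<i>)))"
  define Q where "Q = {z. Re z \<ge> 0 \<and> Im z \<ge> 0}"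
  have holw: "w holomorphic_on Q"
    unfolding w_def Q_def by (intro holomorphic_intros) (auto simp: complex_nonpos_Reals_iff)
  have Rew: "Re (w z) \<ge> c * norm z powr (3/2)" if "z \<in> Q" for z
  proof -
    define v where "v = z + 1 + \<i>"
    have v: "Re v > 0" "Im v > 0" "v \<noteq> 0" using that unfolding v_def Q_def by (auto simp: complex_eq_iff)
    have arg: "0 < Arg v" "Arg v < pi / 2"
      using Arg_lt_pi[of v] Re_Ln_pos_lt[of v] v by (auto simp: Arg_eq_Im_Ln)
    have "exp (3/2 * Ln v) = exp (of_real (3/2 * ln (norm v)) + \<i> * of_real (3/2 * Arg v))"
      using v by (simp add: Ln_Arg algebra_simps)
    also have "\<dots> = of_real (norm v powr (3/2)) * cis (3/2 * Arg v)"
      unfolding exp_add exp_of_real cis_conv_exp using v by (simp add: powr_def)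
    finally have "w z = cis (- (3*pi/8)) * (of_real (norm v powr (3/2)) * cis (3/2 * Arg v))"
      by (simp add: w_def v_def add_ac)
    hence "w z = of_real (norm v powr (3/2)) * cis (3/2 * Arg v - 3*pi/8)"
      by (simp add: cis_mult mult_ac)
    hence "Re (w z) = norm v powr (3/2) * cos (3/2 * Arg v - 3*pi/8)" by simp
    moreover have "cos (3/2 * Arg v - 3*pi/8) \<ge> c"
    proof -
      have "cos \<bar>3/2 * Arg v - 3*pi/8\<bar> \<ge> cos (3*pi/8)"
        using arg by (intro cos_monotone_0_pi_le, simp, intro abs_leI; simp add: field_simps)
      thus ?thesis by (simp add: c_def)
    qed
    moreover have "norm z \<le> norm v"
      using that unfolding v_def Q_def by (auto simp: cmod_def intro!: add_mono power_mono)
    hence "norm z powr (3/2) \<le> norm v powr (3/2)" by (intro powr_mono2) auto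
    ultimately show ?thesis using c
      by (simp, metis mult.commute mult_mono less_eq_real_def norm_ge_zero powr_ge_zero)
  qed
  have key: "norm (H z) \<le> B * exp (e * Re (w z))" if e: "e > 0" for e
  proof -
    define E where "E = (\<lambda>z. H z * exp (- of_real e * w z))"
    have nE: "norm (E u) = norm (H u) * exp (- e * Re (w u))" for u
      by (simp add: E_def norm_mult)
    have nE': "norm (E u) \<le> norm (H u)" if "u \<in> Q" for u
    proof -
      have "0 \<le> Re (w u)" using Rew[OF that] c by (smt (verit) mult_nonneg_nonneg powr_ge_zero)
      thus ?thesis unfolding nE using e by (simp add: mult_left_le)
    qed
    \<comment> \<open>On the arc |u| = R the growth bound times the damping is at most this
      expression, and \<open>R powr (3/2)\<close> beats the linear term.\<close>
    have "((\<lambda>R. C * exp (a * R - e * (c * R powr (3/2)))) \<longlongrightarrow> 0) at_top"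
      using e c by real_asymp
    hence "\<forall>\<^sub>F R in at_top. C * exp (a * R - e * (c * R powr (3/2))) < B"
      using B by (rule order_tendstoD)
    hence "\<forall>\<^sub>F R in at_top. C * exp (a * R - e * (c * R powr (3/2))) < B \<and> R \<ge> norm z + 1"
      using eventually_ge_at_top[of "norm z + 1"] by eventually_elim auto
    then obtain R where R: "C * exp (a * R - e * (c * R powr (3/2))) < B" "R \<ge> norm z + 1"
      by (auto simp: eventually_at_top_linorder)
    define S where "S = Q \<inter> cball 0 R"
    have clQ: "closed Q" unfolding Q_def
      by (intro closed_Collect_conj closed_Collect_le continuous_intros)
    hence clS: "closed S" unfolding S_def by auto
    have hE: "E holomorphic_on S" unfolding E_def
      by (intro holomorphic_intros holomorphic_on_subset[OF H] holomorphic_on_subset[OF holw]) (auto simp: S_def)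
    have "norm (E z) \<le> B"
    proof (rule maximum_modulus_frontier[where f = E and S = S])
      show "E holomorphic_on interior S" using hE interior_subset by (rule holomorphic_on_subset)
      show "continuous_on (closure S) E" using hE clS by (simp add: holomorphic_on_imp_continuous_on)
      show "bounded S" unfolding S_def by auto
      show "z \<in> S" unfolding S_def Q_def using z R by auto
      fix u assume u: "u \<in> frontier S"
      hence uS: "u \<in> S" and ui: "u \<notin> interior S" using clS by (auto simp: frontier_def)
      \<comment> \<open>The strict inequalities cut out an open subset of \<open>S\<close>, so a
        frontier point lies on one of the two axes or on the arc.\<close>
      have "\<not> (Re u > 0 \<and> Im u > 0 \<and> norm u < R)"
      proof
        assume *: "Re u > 0 \<and> Im u > 0 \<and> norm u < R"
        define T where "T = {u. Re u > 0} \<inter> {u. Im u > 0} \<inter> ball 0 R"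
        have "open T" unfolding T_def
          by (intro open_Int open_halfspace_Re_gt open_halfspace_Im_gt open_ball)
        moreover have "T \<subseteq> S" "u \<in> T" using *
          by (auto simp: T_def S_def Q_def)
        ultimately show False using ui interior_maximal by blast
      qed
      then consider "Re u = 0" "Im u \<ge> 0" | "Im u = 0" "Re u \<ge> 0" | "norm u = R"
        using uS by (fastforce simp: S_def Q_def)
      thus "norm (E u) \<le> B"
      proof cases
        case 1
        hence "u = \<i> * of_real (Im u)" by (simp add: complex_eq_iff)
        thus ?thesis using nE'[of u] im[of "Im u"] 1 uS S_def by auto
      next
        case 2
        hence "u = of_real (Re u)" by (simp add: complex_eq_iff)
        thus ?thesis using nE'[of u] re[of "Re u"] 2 uS S_def by auto
      next
        case 3
        have "norm (E u) \<le> C * exp (a * norm u) * exp (- e * Re (w u))"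
          unfolding nE using growth by (intro mult_right_mono) auto
        also have "\<dots> = C * exp (a * R) * exp (- e * Re (w u))" using 3 by simp
        also have "\<dots> \<le> C * exp (a * R) * exp (- e * (c * R powr (3/2)))"
        proof (intro mult_left_mono)
          show "exp (- e * Re (w u)) \<le> exp (- e * (c * R powr (3/2)))"
            using Rew[of u] uS e 3 by (auto simp: S_def)
          show "0 \<le> C * exp (a * R)" using growth[of u] 3 norm_ge_zero order_trans by metis
        qed
        also have "\<dots> < B" using R by (simp add: exp_diff exp_minus field_simps)
        finally show ?thesis by simp
      qed
    qed
    thus ?thesis unfolding nE by (simp add: exp_minus field_simps)
  qed
  have "((\<lambda>e. B * exp (e * Re (w z))) \<longlongrightarrow> B * exp (0 * Re (w z))) (at_right 0)"
    by (intro tendsto_intros)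
  moreover have "\<forall>\<^sub>F e in at_right 0. norm (H z) \<le> B * exp (e * Re (w z))"
    using key by (auto simp: eventually_at_right_less intro: eventually_at_rightI[of 0 1])
  ultimately show ?thesis using tendsto_lowerbound[of _ _ "at_right (0::real)" "norm (H z)"] by fastforce
qed

text \<open>For a bounded function a linear divisor suffices:
  \<open>1 - \<i> * of_real e * u\<close> has modulus at least 1 for Im u >= 0 and grows linearly,
  so the quotient is at most \<open>M\<close> on large arcs as well as on the axis.\<close>

lemma phragmen_lindelof_half_plane_bounded:
  fixes F :: "complex \<Rightarrow> complex"
  assumes F: "F holomorphic_on UNIV"
    and M: "M > 0"
    and re: "\<And>x. norm (F (of_real x)) \<le> M"
    and bd: "\<And>z. Im z \<ge> 0 \<Longrightarrow> norm (F z) \<le> B"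
    and z: "Im z \<ge> 0"
  shows "norm (F z) \<le> M"
proof -
  have key: "norm (F z) \<le> M * norm (1 - \<i> * of_real e * z)" if e: "e > 0" for e
  proof -
    have ge1: "norm (1 - \<i> * of_real e * u) \<ge> 1" if "Im u \<ge> 0" for u
    proof -
      have "1 \<le> Re (1 - \<i> * of_real e * u)" using that e by simp
      also have "\<dots> \<le> norm (1 - \<i> * of_real e * u)" by (rule complex_Re_le_cmod)
      finally show ?thesis .
    qed
    hence nz: "1 - \<i> * of_real e * u \<noteq> 0" if "Im u \<ge> 0" for u
      using that by (metis norm_zero not_one_le_zero)
    define E where "E = (\<lambda>u. F u / (1 - \<i> * of_real e * u))"
    \<comment> \<open>On |u| = R the divisor has modulus at least \<open>e * R - 1\<close>, which
      this choice makes at least \<open>B / M\<close>; the other bound puts \<open>z\<close> inside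
      the disc.\<close>
    define R where "R = max (norm z + 1) ((B / M + 1) / e)"
    have R: "R \<ge> norm z + 1" "R \<ge> (B / M + 1) / e" unfolding R_def by auto
    have clQ: "closed {u. Im u \<ge> 0}"
      by (intro closed_Collect_le continuous_intros)
    define S where "S = {u. Im u \<ge> 0} \<inter> cball 0 R"
    have clS: "closed S" unfolding S_def using clQ by auto
    have hE: "E holomorphic_on S" unfolding E_def
      by (intro holomorphic_intros holomorphic_on_subset[OF F]) (use nz in \<open>auto simp: S_def\<close>)
    have nE: "norm (E u) \<le> norm (F u)" if "Im u \<ge> 0" for u
    proof -
      have "norm (E u) = norm (F u) / norm (1 - \<i> * of_real e * u)" by (simp add: E_def norm_divide)
      also have "\<dots> \<le> norm (F u) / 1" using ge1[OF that] by (intro divide_left_mono) auto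
      finally show ?thesis by simp
    qed
    have "norm (E z) \<le> M"
    proof (rule maximum_modulus_frontier[where f = E and S = S])
      show "E holomorphic_on interior S" using hE interior_subset by (rule holomorphic_on_subset)
      show "continuous_on (closure S) E" using hE clS by (simp add: holomorphic_on_imp_continuous_on)
      show "bounded S" unfolding S_def by auto
      show "z \<in> S" unfolding S_def using z R by auto
      fix u assume u: "u \<in> frontier S"
      hence uS: "u \<in> S" and ui: "u \<notin> interior S" using clS by (auto simp: frontier_def)
      have "\<not> (Im u > 0 \<and> norm u < R)"
      proof
        assume *: "Im u > 0 \<and> norm u < R"
        define T where "T = {u. Im u > 0} \<inter> ball 0 R"
        have "open T" unfolding T_def
          by (intro open_Int open_halfspace_Im_gt open_ball)
        moreover have "T \<subseteq> S" "u \<in> T" using *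
          by (auto simp: T_def S_def)
        ultimately show False using ui interior_maximal by blast
      qed
      then consider "Im u = 0" | "norm u = R" "Im u \<ge> 0"
        using uS by (fastforce simp: S_def)
      thus "norm (E u) \<le> M"
      proof cases
        case 1
        hence "u = of_real (Re u)" by (simp add: complex_eq_iff)
        thus ?thesis using nE[of u] re[of "Re u"] 1 by auto
      next
        case 2
        have "B / M + 1 \<le> e * R" using R(2) e by (simp add: divide_le_eq mult.commute)
        also have "e * R = norm (\<i> * of_real e * u)" using 2 e by (simp add: norm_mult)
        also have "\<dots> \<le> norm (1 - \<i> * of_real e * u) + 1"
          using norm_triangle_ineq4[of 1 "1 - \<i> * of_real e * u"] by simp
        finally have "B / M \<le> norm (1 - \<i> * of_real e * u)" by simp
        hence "B \<le> M * norm (1 - \<i> * of_real e * u)" using M by (simp add: divide_le_eq mult.commute)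
        with bd[of u] 2 have "norm (F u) \<le> M * norm (1 - \<i> * of_real e * u)" by simp
        thus ?thesis using nz[of u] 2 by (simp add: E_def norm_divide divide_le_eq)
      qed
    qed
    thus ?thesis using nz[OF z] by (simp add: E_def norm_divide divide_le_eq)
  qed
  have "((\<lambda>e. M * norm (1 - \<i> * of_real e * z)) \<longlongrightarrow> M * norm (1 - \<i> * of_real 0 * z)) (at_right 0)"
    by (intro tendsto_intros)
  moreover have "\<forall>\<^sub>F e in at_right 0. norm (F z) \<le> M * norm (1 - \<i> * of_real e * z)"
    using key by (auto intro: eventually_at_rightI[of 0 1])
  ultimately show ?thesis using tendsto_lowerbound[of _ _ "at_right (0::real)" "norm (F z)"] by fastforce
qed

text \<open>Multiplying by exp(i (s + e) z) cancels the growth on the positive imaginary axis and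
  keeps moduli on the real axis. The quadrant version on both quarters gives some bound, which the
  bounded version improves to the one on the real axis. The limits e -> 0 and N -> M come
  last.\<close>

lemma phragmen_lindelof_half_plane:
  fixes G :: "complex \<Rightarrow> complex"
  assumes G: "G holomorphic_on UNIV"
    and growth: "\<And>e. e > 0 \<Longrightarrow> \<exists>C. \<forall>z. norm (G z) \<le> C * exp ((s + e) * norm z)"
    and s: "s \<ge> 0"
    and re: "\<And>x. norm (G (of_real x)) \<le> M"
    and z: "Im z \<ge> 0"
  shows "norm (G z) \<le> M * exp (s * Im z)"
proof -
  \<comment> \<open>\<open>M\<close> may be 0, while the bounded version asks for a positive bound;
    hence the strict majorant \<open>N\<close>.\<close>
  have key: "norm (G z) \<le> N * exp ((s + e) * Im z)" if e: "e > 0" and N: "N > M" for e N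
  proof -
    have N0: "N > 0" using re[of 0] N by (smt (verit) norm_ge_zero)
    obtain C where C: "\<And>z. norm (G z) \<le> C * exp ((s + e) * norm z)" using growth[OF e] by blast
    have C0: "C \<ge> 0" using order_trans[OF norm_ge_zero C[of 0]] by simp
    define F where "F = (\<lambda>u. G u * exp (\<i> * of_real (s + e) * u))"
    have nF: "norm (F u) = norm (G u) * exp (- ((s + e) * Im u))" for u
      by (simp add: F_def norm_mult algebra_simps)
    have F: "F holomorphic_on UNIV" unfolding F_def by (intro holomorphic_intros G)
    have FN: "norm (F (of_real x)) \<le> N" for x
      using re[of x] N by (simp add: nF)
    define B where "B = max N C"
    have B: "B > 0" "N \<le> B" "C \<le> B" using N0 by (auto simp: B_def)
    have FB: "norm (F (\<i> * of_real y)) \<le> B" if "y \<ge> 0" for y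
    proof -
      have "norm (F (\<i> * of_real y)) \<le> C * exp ((s + e) * norm (\<i> * of_real y)) * exp (- ((s + e) * y))"
        unfolding nF using C[of "\<i> * of_real y"] C0 by (intro mult_mono) auto
      also have "\<dots> = C" using that by (simp add: norm_mult exp_minus_inverse mult.assoc)
      finally show ?thesis using B by simp
    qed
    have gF: "norm (F u) \<le> C * exp ((2 * (s + e)) * norm u)" for u
    proof -
      have "norm (F u) \<le> C * exp ((s + e) * norm u) * exp ((s + e) * norm u)"
        unfolding nF
      proof (intro mult_mono C)
        have "- Im u \<le> norm u" using abs_Im_le_cmod[of u] by linarith
        hence "(s + e) * (- Im u) \<le> (s + e) * norm u" using s e by (intro mult_left_mono) auto
        thus "exp (- ((s + e) * Im u)) \<le> exp ((s + e) * norm u)" by simp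
      qed (use C0 in auto)
      also have "\<dots> = C * exp ((2 * (s + e)) * norm u)"
        by (simp add: mult.assoc flip: exp_add)
      finally show ?thesis .
    qed
    have bd: "norm (F u) \<le> B" if u: "Im u \<ge> 0" for u
    proof (cases "Re u \<ge> 0")
      case True
      show ?thesis
        by (rule phragmen_lindelof_quadrant[OF F gF]) (use B FB FN u True in \<open>auto intro: order_trans\<close>)
    next
      case False
      \<comment> \<open>Rotation by -i carries the second quadrant to the first: the real half-axis
        then comes from the imaginary one, and the imaginary one from the negative reals.\<close>
      have "norm (F (\<i> * (- \<i> * u))) \<le> B"
      proof (rule phragmen_lindelof_quadrant[where H = "\<lambda>w. F (\<i> * w)" and z = "- \<i> * u"])
        have "F \<circ> (\<lambda>w. \<i> * w) holomorphic_on UNIV"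
          by (intro holomorphic_on_compose_gen[OF _ F] holomorphic_intros) auto
        thus "(\<lambda>w. F (\<i> * w)) holomorphic_on UNIV" by (simp add: o_def)
        show "norm (F (\<i> * w)) \<le> C * exp ((2 * (s + e)) * norm w)" for w
          using gF[of "\<i> * w"] by (simp add: norm_mult)
        show "norm (F (\<i> * (\<i> * complex_of_real y))) \<le> B" for y
          using FN[of "-y"] B by (simp add: mult.assoc[symmetric])
      qed (use B FB False u in auto)
      thus ?thesis by (simp add: mult.assoc[symmetric])
    qed
    have "norm (F z) \<le> N"
      using phragmen_lindelof_half_plane_bounded[OF F N0 FN bd z] .
    thus ?thesis unfolding nF exp_minus by (simp add: field_simps)
  qed
  have 1: "norm (G z) \<le> N * exp (s * Im z)" if N: "N > M" for N
  proof -
    have "((\<lambda>e. N * exp ((s + e) * Im z)) \<longlongrightarrow> N * exp ((s + 0) * Im z)) (at_right 0)"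
      by (intro tendsto_intros)
    moreover have "\<forall>\<^sub>F e in at_right 0. norm (G z) \<le> N * exp ((s + e) * Im z)"
      using key[OF _ N] by (auto intro: eventually_at_rightI[of 0 1])
    ultimately show ?thesis using tendsto_lowerbound[of _ _ "at_right (0::real)" "norm (G z)"] by fastforce
  qed
  have "norm (G z) / exp (s * Im z) \<le> M"
    by (rule dense_ge) (use 1 in \<open>simp add: field_simps\<close>)
  thus ?thesis by (simp add: field_simps)
qed

section \<open>Disc means of powers of holomorphic functions\<close>

text \<open>The graph of x^r lies above its tangent at \<open>b\<close>; equivalently, this is
  Young's inequality for \<open>a\<close> and \<open>b powr (r - 1)\<close>. Being linear in a^r and
  b^r, it can be integrated termwise, also for r = 1.\<close>

lemma powr_tangent:
  fixes a b r :: real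
  assumes "a \<ge> 0" "b \<ge> 0" "r \<ge> 1"
  shows "r * (a * b powr (r - 1)) \<le> a powr r + (r - 1) * b powr r"
\<comment> \<open>\<open>0 powr x\<close> is 0 for every \<open>x\<close>, also for x = 0; zeros are
  split off because Young's inequality is used for positive arguments.\<close>
proof (cases "a = 0 \<or> b = 0")
  case True
  thus ?thesis using assms by auto
next
  case False
  have "(a powr r) powr (1/r) * (b powr r) powr (1 - 1/r) \<le> (1/r) * a powr r + (1 - 1/r) * b powr r"
    using assms False by (intro Youngs_inequality_0) auto
  moreover have "(a powr r) powr (1/r) = a"
    using assms by (simp add: powr_powr)
  moreover have "(b powr r) powr (1 - 1/r) = b powr (r - 1)"
    using assms by (simp add: powr_powr right_diff_distrib)
  ultimately have "a * b powr (r - 1) \<le> (1/r) * a powr r + (1 - 1/r) * b powr r" by simp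
  hence "r * (a * b powr (r - 1)) \<le> r * ((1/r) * a powr r + (1 - 1/r) * b powr r)"
    using assms by (intro mult_left_mono) auto
  also have "\<dots> = a powr r + (r - 1) * b powr r"
    using assms by (simp add: ring_distribs)
  finally show ?thesis .
qed

section \<open>Rotation invariance of area integrals\<close>

lemma nn_integral_lborel_shift:
  fixes f :: "real \<Rightarrow> ennreal"
  assumes "f \<in> borel_measurable borel"
  shows "(\<integral>\<^sup>+x. f (x + a) \<partial>lborel) = (\<integral>\<^sup>+x. f x \<partial>lborel)"
  using nn_integral_real_affine[OF assms, of 1 a] by (simp add: add.commute)

lemma nn_integral_shear1:
  fixes F :: "real \<Rightarrow> real \<Rightarrow> ennreal"
  assumes F[measurable]: "(\<lambda>(x, y). F x y) \<in> borel_measurable (borel \<Otimes>\<^sub>M borel)"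
  shows "(\<integral>\<^sup>+y. \<integral>\<^sup>+x. F (x + a * y) y \<partial>lborel \<partial>lborel) = (\<integral>\<^sup>+y. \<integral>\<^sup>+x. F x y \<partial>lborel \<partial>lborel)"
  by (intro nn_integral_cong nn_integral_lborel_shift) measurable

lemma nn_integral_shear2:
  fixes F :: "real \<Rightarrow> real \<Rightarrow> ennreal"
  assumes F[measurable]: "(\<lambda>(x, y). F x y) \<in> borel_measurable (borel \<Otimes>\<^sub>M borel)"
  shows "(\<integral>\<^sup>+y. \<integral>\<^sup>+x. F x (y + a * x) \<partial>lborel \<partial>lborel) = (\<integral>\<^sup>+y. \<integral>\<^sup>+x. F x y \<partial>lborel \<partial>lborel)"
proof -
  have "(\<integral>\<^sup>+y. \<integral>\<^sup>+x. F x (y + a * x) \<partial>lborel \<partial>lborel) = (\<integral>\<^sup>+x. \<integral>\<^sup>+y. F x (y + a * x) \<partial>lborel \<partial>lborel)"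
    by (rule lborel_pair.Fubini') measurable
  also have "\<dots> = (\<integral>\<^sup>+x. \<integral>\<^sup>+y. F x y \<partial>lborel \<partial>lborel)"
    by (intro nn_integral_cong nn_integral_lborel_shift) measurable
  also have "\<dots> = (\<integral>\<^sup>+y. \<integral>\<^sup>+x. F x y \<partial>lborel \<partial>lborel)"
    by (rule lborel_pair.Fubini'[symmetric]) measurable
  finally show ?thesis .
qed

text \<open>The half turn \<open>c = -1\<close> is left out because the half-angle tangent is
  infinite there; a single angle is a null set in the average over angles for which this is
  meant.\<close>

lemma nn_integral_rotation:
  fixes F :: "real \<Rightarrow> real \<Rightarrow> ennreal"
  assumes F[measurable]: "(\<lambda>(x, y). F x y) \<in> borel_measurable (borel \<Otimes>\<^sub>M borel)"
    and cs: "c\<^sup>2 + s\<^sup>2 = 1" "c \<noteq> -1"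
  shows "(\<integral>\<^sup>+y. \<integral>\<^sup>+x. F (c * x - s * y) (s * x + c * y) \<partial>lborel \<partial>lborel)
       = (\<integral>\<^sup>+y. \<integral>\<^sup>+x. F x y \<partial>lborel \<partial>lborel)"
proof -
  \<comment> \<open>A rotation by \<open>\<theta>\<close> is a product of three shears with slopes \<open>-tan (\<theta>/2)\<close>, \<open>sin \<theta>\<close>, \<open>-tan (\<theta>/2)\<close>.\<close>
  define t where "t = - (s / (1 + c))"
  have c: "1 + c \<noteq> 0" using cs by auto
  have "(1 - c) * (1 + c) = s * s" using cs by (simp add: power2_eq_square algebra_simps)
  hence ts: "1 + t * s = c" using c unfolding t_def by (simp add: field_simps)
  have tc: "t * (1 + c) = - s" using c by (simp add: t_def)
  have "(x + t * y) + t * (y + s * (x + t * y)) = c * x - s * y"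
       "y + s * (x + t * y) = s * x + c * y" for x y
  proof -
    have "(x + t * y) + t * (y + s * (x + t * y)) = (1 + t * s) * x + t * (1 + (1 + t * s)) * y"
      by (simp add: algebra_simps)
    also have "\<dots> = c * x - s * y" unfolding ts tc by simp
    finally show "(x + t * y) + t * (y + s * (x + t * y)) = c * x - s * y" .
    have "y + s * (x + t * y) = s * x + (1 + t * s) * y" by (simp add: algebra_simps)
    thus "y + s * (x + t * y) = s * x + c * y" unfolding ts .
  qed
  hence "(\<integral>\<^sup>+y. \<integral>\<^sup>+x. F (c * x - s * y) (s * x + c * y) \<partial>lborel \<partial>lborel)
    = (\<integral>\<^sup>+y. \<integral>\<^sup>+x. F ((x + t * y) + t * (y + s * (x + t * y))) (y + s * (x + t * y)) \<partial>lborel \<partial>lborel)"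
    by simp
  also have "\<dots> = (\<integral>\<^sup>+y. \<integral>\<^sup>+x. F (x + t * (y + s * x)) (y + s * x) \<partial>lborel \<partial>lborel)"
    by (rule nn_integral_shear1[where F = "\<lambda>x y. F (x + t * (y + s * x)) (y + s * x)"]) measurable
  also have "\<dots> = (\<integral>\<^sup>+y. \<integral>\<^sup>+x. F (x + t * y) y \<partial>lborel \<partial>lborel)"
    by (rule nn_integral_shear2[where F = "\<lambda>x y. F (x + t * y) y"]) measurable
  also have "\<dots> = (\<integral>\<^sup>+y. \<integral>\<^sup>+x. F x y \<partial>lborel \<partial>lborel)"
    by (rule nn_integral_shear1) measurable
  finally show ?thesis .
qed

section \<open>Means over circles and discs\<close>

lemma nn_integral_interval_eq_integral:
  fixes u :: "real \<Rightarrow> real"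
  assumes u: "continuous_on UNIV u" and nonneg: "\<And>t. u t \<ge> 0"
  shows "(\<integral>\<^sup>+t. ennreal (u t) * indicator {a..b} t \<partial>lborel) = ennreal (integral {a..b} u)"
proof -
  have "(u has_integral integral {a..b} u) {a..b}"
    using u by (intro integrable_integral integrable_continuous_interval continuous_on_subset[OF u]) auto
  hence "((\<lambda>t. if t \<in> {a..b} then u t else 0) has_integral integral {a..b} u) UNIV"
    by (subst has_integral_restrict_UNIV)
  also have "(\<lambda>t. if t \<in> {a..b} then u t else 0) = (\<lambda>t. u t * indicator {a..b} t)"
    by (auto simp: indicator_def)
  finally have "(\<integral>\<^sup>+t. ennreal (u t * indicator {a..b} t) \<partial>lborel) = ennreal (integral {a..b} u)"
  proof (intro nn_integral_has_integral_lborel)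
    have [measurable]: "u \<in> borel_measurable borel" by (rule borel_measurable_continuous_onI[OF u])
    show "(\<lambda>t. u t * indicator {a..b} t) \<in> borel_measurable borel" by measurable
  qed (use nonneg in auto)
  moreover have "ennreal (u t * indicator {a..b} t) = ennreal (u t) * indicator {a..b} t" for t
    by (simp add: indicator_def)
  ultimately show ?thesis by simp
qed

text \<open>Cauchy's formula gives the mean value identity for \<open>g\<close> itself; the tangent
  inequality at b = |g z| then yields Jensen's inequality for the r-th power. The circle is the
  image of the unit circle under u -> z + u w, so w = 0 is included.\<close>

lemma holomorphic_circle_mean_powr:
  fixes g :: "complex \<Rightarrow> complex"
  assumes g: "g holomorphic_on UNIV" and r: "r \<ge> 1"
  shows "ennreal (2 * pi * norm (g z) powr r)
    \<le> (\<integral>\<^sup>+t. ennreal (norm (g (z + cis t * w)) powr r) * indicator {0..2*pi} t \<partial>lborel)"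
proof -
  have contg: "continuous_on A g" for A
    using g holomorphic_on_imp_continuous_on holomorphic_on_subset by blast
  have "(\<lambda>u. g (z + u * w)) holomorphic_on UNIV"
  proof -
    have "g \<circ> (\<lambda>u. z + u * w) holomorphic_on UNIV"
      by (intro holomorphic_on_compose_gen[OF _ g] holomorphic_intros) auto
    thus ?thesis by (simp add: o_def)
  qed
  hence "((\<lambda>u. g (z + u * w) / (u - 0)) has_contour_integral (2 * of_real pi * \<i> * g (z + 0 * w))) (circlepath 0 1)"
    by (intro Cauchy_integral_circlepath_simple) (auto intro: holomorphic_on_subset)
  hence "((\<lambda>t. g (z + cis t * w) / cis t * \<i> * cis t) has_integral (2 * of_real pi * \<i> * g z)) {0..2*pi}"
    unfolding circlepath_def by (subst (asm) has_contour_integral_part_circlepath_iff) auto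
  hence "((\<lambda>t. - \<i> * (g (z + cis t * w) / cis t * \<i> * cis t)) has_integral - \<i> * (2 * of_real pi * \<i> * g z)) {0..2*pi}"
    by (rule has_integral_mult_right)
  hence "((\<lambda>t. g (z + cis t * w)) has_integral 2 * of_real pi * g z) {0..2*pi}"
    by (simp add: mult_ac)
  hence int: "integral {0..2*pi} (\<lambda>t. g (z + cis t * w)) = 2 * of_real pi * g z" by (rule integral_unique)
  define b where "b = norm (g z)"
  have b: "b \<ge> 0" by (simp add: b_def)
  let ?u = "\<lambda>t. norm (g (z + cis t * w))"
  have cont: "continuous_on A (\<lambda>t. g (z + cis t * w))" for A
    by (intro continuous_on_compose2[OF contg[of UNIV]] continuous_intros) auto
  have contr: "continuous_on A (\<lambda>t. ?u t powr r)" for A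
    using r by (intro continuous_on_powr' continuous_intros cont) auto
  have "2 * pi * b = norm (integral {0..2*pi} (\<lambda>t. g (z + cis t * w)))"
    unfolding int b_def by (simp add: norm_mult)
  also have "\<dots> \<le> integral {0..2*pi} ?u"
    by (intro integral_norm_bound_integral integrable_continuous_interval continuous_intros cont) auto
  finally have 1: "2 * pi * b \<le> integral {0..2*pi} ?u" .
  \<comment> \<open>Multiplying by r b^(r - 1) prepares the tangent inequality; of the r copies of 2
    pi b^r on the left, r - 1 cancel against the right.\<close>
  have "r * (2 * pi * b) * b powr (r - 1) \<le> r * integral {0..2*pi} ?u * b powr (r - 1)"
    using 1 r by (intro mult_right_mono mult_left_mono) auto
  also have "\<dots> = integral {0..2*pi} (\<lambda>t. r * (?u t * b powr (r - 1)))" by (simp add: mult_ac)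
  also have "\<dots> \<le> integral {0..2*pi} (\<lambda>t. ?u t powr r + (r - 1) * b powr r)"
    using r b by (intro integral_le integrable_continuous_interval continuous_intros cont contr powr_tangent) auto
  also have "\<dots> = integral {0..2*pi} (\<lambda>t. ?u t powr r) + 2 * pi * (r - 1) * b powr r"
    by (subst integral_add) (auto intro!: integrable_continuous_interval contr)
  finally have "r * (2 * pi * (b * b powr (r - 1))) \<le> integral {0..2*pi} (\<lambda>t. ?u t powr r) + 2 * pi * (r - 1) * b powr r"
    by (simp add: mult_ac)
  moreover have "b * b powr (r - 1) = b powr r"
    using b r by (cases "b = 0") (auto simp: powr_mult_base)
  ultimately have main: "2 * pi * b powr r \<le> integral {0..2*pi} (\<lambda>t. ?u t powr r)"
    by (simp add: algebra_simps)
  show ?thesis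
    using main unfolding b_def by (subst nn_integral_interval_eq_integral[OF contr]) (auto intro: ennreal_leI)
qed

lemma measurable_Complex [measurable (raw)]:
  assumes "f \<in> borel_measurable M" "g \<in> borel_measurable M"
  shows "(\<lambda>x. Complex (f x) (g x)) \<in> borel_measurable M"
  unfolding Complex_eq using assms by measurable

lemma nn_integral_disc_area:
  assumes "\<rho> \<ge> 0"
  shows "(\<integral>\<^sup>+y. \<integral>\<^sup>+x. indicator (ball 0 \<rho>) (Complex x y) \<partial>lborel \<partial>lborel) = ennreal (pi * \<rho>\<^sup>2)"
proof -
  have "indicator (ball 0 \<rho>) (Complex x y) = (indicator (ball 0 \<rho>) (x, y) :: ennreal)" for x y
    by (simp add: indicator_def norm_Pair cmod_def)
  hence "(\<integral>\<^sup>+y. \<integral>\<^sup>+x. indicator (ball 0 \<rho>) (Complex x y) \<partial>lborel \<partial>lborel)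
      = (\<integral>\<^sup>+y. \<integral>\<^sup>+x. indicator (ball 0 \<rho>) (x::real, y::real) \<partial>lborel \<partial>lborel)"
    by simp
  also have "\<dots> = (\<integral>\<^sup>+p. indicator (ball (0::real\<times>real) \<rho>) p \<partial>(lborel \<Otimes>\<^sub>M lborel))"
  proof (rule lborel_pair.nn_integral_snd[where f = "indicator (ball 0 \<rho>)"])
    have "ball (0::real\<times>real) \<rho> \<in> sets (borel \<Otimes>\<^sub>M borel)" unfolding borel_prod by simp
    thus "(indicator (ball (0::real\<times>real) \<rho>) :: _ \<Rightarrow> ennreal) \<in> borel_measurable (lborel \<Otimes>\<^sub>M lborel)"
      by measurable
  qed
  also have "\<dots> = emeasure lborel (ball (0::real \<times> real) \<rho>)"
    by (simp add: lborel_prod)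
  also have "\<dots> = ennreal (pi * \<rho>\<^sup>2)"
    using assms by (subst emeasure_ball) (auto simp: unit_ball_vol_2 power2_eq_square)
  finally show ?thesis .
qed

text \<open>Averaging over all rotations of the disc reduces this to circle means without polar coordinates.\<close>
lemma holomorphic_disc_mean_powr:
  fixes g :: "complex \<Rightarrow> complex"
  assumes g: "g holomorphic_on UNIV" and r: "r \<ge> 1" and rho: "\<rho> \<ge> 0"
  shows "ennreal (pi * \<rho>\<^sup>2 * norm (g z) powr r)
    \<le> (\<integral>\<^sup>+y. \<integral>\<^sup>+x. ennreal (norm (g (Complex x y)) powr r) * indicator (ball z \<rho>) (Complex x y) \<partial>lborel \<partial>lborel)"
proof -
  define F :: "real \<Rightarrow> real \<Rightarrow> ennreal" where
    "F = (\<lambda>x y. ennreal (norm (g (z + Complex x y)) powr r) * indicator (ball 0 \<rho>) (Complex x y))"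
  let ?I = "\<integral>\<^sup>+y. \<integral>\<^sup>+x. F x y \<partial>lborel \<partial>lborel"
  have contg: "continuous_on A g" for A
    using g holomorphic_on_imp_continuous_on holomorphic_on_subset by blast
  have [measurable]: "g \<in> borel_measurable borel"
    by (rule borel_measurable_continuous_onI[OF contg])
  have [measurable]: "ball w \<rho> \<in> sets borel" for w :: complex by simp
  have F[measurable]: "(\<lambda>(x, y). F x y) \<in> borel_measurable (borel \<Otimes>\<^sub>M borel)"
    unfolding F_def by measurable
  have rot: "(\<integral>\<^sup>+y. \<integral>\<^sup>+x. F (cos t * x - sin t * y) (sin t * x + cos t * y) \<partial>lborel \<partial>lborel) = ?I"
    if t: "t \<in> {0..2*pi}" "t \<noteq> pi" for t
  proof (rule nn_integral_rotation)
    show "cos t \<noteq> -1"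
    proof
      assume "cos t = -1"
      then obtain k :: int where k: "t = (2 * k + 1) * pi" by (auto simp: cos_eq_minus1)
      hence "0 \<le> 2 * real_of_int k + 1" "2 * real_of_int k + 1 \<le> 2" using t pi_gt_zero
        by (simp_all add: zero_le_mult_iff del: pi_gt_zero)
      hence "k = 0" by linarith
      thus False using k t by simp
    qed
  qed auto
  have cis: "Complex (cos t * x - sin t * y) (sin t * x + cos t * y) = cis t * Complex x y" for t x y
    by (simp add: complex_eq_iff algebra_simps)
  \<comment> \<open>Integration over the angle brings a factor 2 pi to both sides, which is
    cancelled at the end.\<close>
  have "ennreal (pi * \<rho>\<^sup>2 * norm (g z) powr r) * ennreal (2 * pi)
    = ennreal (2 * pi * norm (g z) powr r) * (\<integral>\<^sup>+y. \<integral>\<^sup>+x. indicator (ball 0 \<rho>) (Complex x y) \<partial>lborel \<partial>lborel)"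
    unfolding nn_integral_disc_area[OF rho] using r
    by (subst (1 2) ennreal_mult[symmetric]) (auto simp: mult_ac)
  also have "\<dots> = (\<integral>\<^sup>+y. \<integral>\<^sup>+x. ennreal (2 * pi * norm (g z) powr r) * indicator (ball 0 \<rho>) (Complex x y) \<partial>lborel \<partial>lborel)"
    by (simp add: nn_integral_cmult)
  \<comment> \<open>Rotations preserve the disc, so on the whole circle through one of its points
    \<open>F\<close> is the full power of |g|, and the circle mean applies.\<close>
  also have "\<dots> \<le> (\<integral>\<^sup>+y. \<integral>\<^sup>+x. (\<integral>\<^sup>+t. F (cos t * x - sin t * y) (sin t * x + cos t * y) * indicator {0..2*pi} t \<partial>lborel) \<partial>lborel \<partial>lborel)"
  proof (intro nn_integral_mono)
    fix x y
    show "ennreal (2 * pi * norm (g z) powr r) * indicator (ball 0 \<rho>) (Complex x y)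
      \<le> (\<integral>\<^sup>+t. F (cos t * x - sin t * y) (sin t * x + cos t * y) * indicator {0..2*pi} t \<partial>lborel)"
      using holomorphic_circle_mean_powr[OF g r, of z "Complex x y"]
      by (cases "Complex x y \<in> ball 0 \<rho>") (auto simp: F_def cis norm_mult)
  qed
  also have "\<dots> = (\<integral>\<^sup>+y. (\<integral>\<^sup>+t. \<integral>\<^sup>+x. F (cos t * x - sin t * y) (sin t * x + cos t * y) * indicator {0..2*pi} t \<partial>lborel \<partial>lborel) \<partial>lborel)"
    by (intro nn_integral_cong lborel_pair.Fubini') measurable
  also have "\<dots> = (\<integral>\<^sup>+t. (\<integral>\<^sup>+y. \<integral>\<^sup>+x. F (cos t * x - sin t * y) (sin t * x + cos t * y) * indicator {0..2*pi} t \<partial>lborel \<partial>lborel) \<partial>lborel)"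
    by (intro lborel_pair.Fubini') measurable
  also have "\<dots> = (\<integral>\<^sup>+t. (\<integral>\<^sup>+y. \<integral>\<^sup>+x. F (cos t * x - sin t * y) (sin t * x + cos t * y) \<partial>lborel \<partial>lborel) * indicator {0..2*pi} t \<partial>lborel)"
    by (simp add: nn_integral_multc)
  \<comment> \<open>By rotation invariance the double integral does not depend on the angle, up to
    the null set {pi} left out above.\<close>
  also have "\<dots> = (\<integral>\<^sup>+t. ?I * indicator {0..2*pi} t \<partial>lborel)"
  proof (rule nn_integral_cong_AE)
    have "AE t in lborel. t \<noteq> pi" by (rule AE_lborel_singleton)
    thus "AE t in lborel. (\<integral>\<^sup>+y. \<integral>\<^sup>+x. F (cos t * x - sin t * y) (sin t * x + cos t * y) \<partial>lborel \<partial>lborel) * indicator {0..2*pi} t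
       = ?I * indicator {0..2*pi} t"
      by eventually_elim (auto simp: rot indicator_def)
  qed
  also have "\<dots> = ?I * ennreal (2 * pi)"
    by (subst nn_integral_cmult) auto
  finally have "ennreal (pi * \<rho>\<^sup>2 * norm (g z) powr r) \<le> ?I"
    by (subst (asm) (1 2) mult.commute, subst (asm) ennreal_mult_le_mult_iff) auto
  also have "?I = (\<integral>\<^sup>+y. \<integral>\<^sup>+x. ennreal (norm (g (Complex (x + Re z) (y + Im z))) powr r)
      * indicator (ball z \<rho>) (Complex (x + Re z) (y + Im z)) \<partial>lborel \<partial>lborel)"
  proof -
    have "z + Complex x y = Complex (x + Re z) (y + Im z)" for x y by (simp add: complex_eq_iff)
    moreover have "Complex (x + Re z) (y + Im z) \<in> ball z \<rho> \<longleftrightarrow> Complex x y \<in> ball 0 \<rho>" for x y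
      by (simp add: dist_norm cmod_def)
    ultimately show ?thesis by (simp add: F_def indicator_def)
  qed
  also have "\<dots> = (\<integral>\<^sup>+y. \<integral>\<^sup>+x. ennreal (norm (g (Complex x (y + Im z))) powr r)
      * indicator (ball z \<rho>) (Complex x (y + Im z)) \<partial>lborel \<partial>lborel)"
    by (intro nn_integral_cong nn_integral_lborel_shift) measurable
  also have "\<dots> = (\<integral>\<^sup>+y. \<integral>\<^sup>+x. ennreal (norm (g (Complex x y)) powr r) * indicator (ball z \<rho>) (Complex x y) \<partial>lborel \<partial>lborel)"
    by (rule nn_integral_lborel_shift[where f = "\<lambda>y. \<integral>\<^sup>+x. ennreal (norm (g (Complex x y)) powr r) * indicator (ball z \<rho>) (Complex x y) \<partial>lborel"]) measurable
  finally show ?thesis .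
qed

section \<open>The Plancherel-Polya inequality\<close>

text \<open>Differentiation under the integral over a compact interval; this makes the function
  \<open>G\<close> of the duality argument entire.\<close>

lemma holomorphic_convolution:
  fixes g \<phi> :: "_ \<Rightarrow> complex"
  assumes g: "g holomorphic_on UNIV" and \<phi>: "continuous_on {a..b} \<phi>"
  shows "(\<lambda>z. integral {a..b} (\<lambda>u. g (z + of_real u) * \<phi> u)) holomorphic_on UNIV"
proof -
  have contg: "continuous_on A g" for A
    using g holomorphic_on_imp_continuous_on holomorphic_on_subset by blast
  have contd: "continuous_on UNIV (deriv g)"
    by (intro holomorphic_on_imp_continuous_on holomorphic_deriv g) auto
  have "(\<lambda>z. integral (cbox a b) (\<lambda>u. g (z + of_real u) * \<phi> u)) holomorphic_on UNIV"
  proof (rule leibniz_rule_holomorphic)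
    show "((\<lambda>z. g (z + of_real u) * \<phi> u) has_field_derivative deriv g (z + of_real u) * \<phi> u) (at z within UNIV)" for z u
    proof -
      have "(g has_field_derivative deriv g (z + of_real u)) (at (z + of_real u))"
        using g by (intro holomorphic_derivI[of _ UNIV]) auto
      hence "((\<lambda>z. g (z + of_real u)) has_field_derivative deriv g (z + of_real u)) (at z)"
        using DERIV_shift by blast
      thus ?thesis by (intro DERIV_cmult_right) simp
    qed
    show "(\<lambda>u. g (z + of_real u) * \<phi> u) integrable_on cbox a b" for z
      by (intro integrable_continuous continuous_intros continuous_on_compose2[OF contg[of UNIV]])
         (use \<phi> in auto)
    show "continuous_on (UNIV \<times> cbox a b) (\<lambda>(z, u). deriv g (z + of_real u) * \<phi> u)"
      unfolding split_def
      by (intro continuous_intros continuous_on_compose2[OF contd] continuous_on_compose2[OF \<phi>]) auto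
  qed auto
  thus ?thesis by simp
qed

text \<open>The kernel built from \<open>h\<close> makes the convolution at iy nearly
  \<open>J\<close>, while on the real line Young's inequality bounds it through \<open>I\<close> and
  \<open>J\<close>. Phragmen-Lindeloef links the two and leaves r J <= l^r I + (r - 1) J. Absorbing
  (r - 1) J needs \<open>J\<close> finite, which the compact interval ensures.\<close>

lemma plancherel_polya_interval:
  fixes g :: "complex \<Rightarrow> complex"
  assumes g: "g holomorphic_on UNIV"
    and growth: "\<And>e. e > 0 \<Longrightarrow> \<exists>C. \<forall>z. norm (g z) \<le> C * exp ((s + e) * norm z)"
    and s: "s \<ge> 0" and r: "r \<ge> 1" and y: "y \<ge> 0"
    and I: "(\<integral>\<^sup>+x. ennreal (norm (g (of_real x)) powr r) \<partial>lborel) \<le> ennreal I" "I \<ge> 0"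
    and A: "A \<ge> 0"
  shows "integral {-A..A} (\<lambda>u. norm (g (of_real u + \<i> * of_real y)) powr r) \<le> exp (r * (s * y)) * I"
proof -
  have contg: "continuous_on B g" for B
    using g holomorphic_on_imp_continuous_on holomorphic_on_subset by blast
  define h where "h = (\<lambda>u. g (of_real u + \<i> * of_real y))"
  define J where "J = integral {-A..A} (\<lambda>u. norm (h u) powr r)"
  \<comment> \<open>The factor gained by Phragmen-Lindeloef between height 0 and height
    \<open>y\<close>. Giving |g| the weight \<open>l\<close> in Young's inequality makes the final
    constant exactly \<open>l powr r\<close>.\<close>
  define l where "l = exp (s * y)"
  have l: "l > 0" "l powr r = exp (r * (s * y))" by (simp_all add: l_def powr_def)
  have conth [continuous_intros]: "continuous_on B h" for B
    unfolding h_def by (intro continuous_on_compose2[OF contg[of UNIV]] continuous_intros) auto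
  have contpow [continuous_intros]: "continuous_on B (\<lambda>u. norm (f u) powr r)"
    if "continuous_on B f" for B and f :: "real \<Rightarrow> complex"
    using r that by (intro continuous_on_powr' continuous_intros) auto
  have contgx [continuous_intros]: "continuous_on B (\<lambda>u. g (z + of_real u))" for B :: "real set" and z
    by (intro continuous_on_compose2[OF contg[of UNIV]] continuous_intros) auto
  have gI: "integral {-A..A} (\<lambda>u. norm (g (of_real x + of_real u)) powr r) \<le> I" for x
  proof -
    have [measurable]: "g \<in> borel_measurable borel"
      by (rule borel_measurable_continuous_onI[OF contg])
    have "ennreal (integral {-A..A} (\<lambda>u. norm (g (of_real x + of_real u)) powr r))
      = (\<integral>\<^sup>+u. ennreal (norm (g (of_real x + of_real u)) powr r) * indicator {-A..A} u \<partial>lborel)"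
      by (intro nn_integral_interval_eq_integral[symmetric] continuous_intros) auto
    also have "\<dots> \<le> (\<integral>\<^sup>+u. ennreal (norm (g (of_real (u + x))) powr r) \<partial>lborel)"
      by (intro nn_integral_mono) (auto simp: indicator_def add.commute)
    also have "\<dots> = (\<integral>\<^sup>+u. ennreal (norm (g (of_real u)) powr r) \<partial>lborel)"
      by (rule nn_integral_lborel_shift[where f = "\<lambda>u. ennreal (norm (g (of_real u)) powr r)"]) measurable
    finally have "ennreal (integral {-A..A} (\<lambda>u. norm (g (of_real x + of_real u)) powr r)) \<le> ennreal I"
      using I(1) by (rule order_trans)
    thus ?thesis using I(2) by simp
  qed
  have main: "r * integral {-A..A} (\<lambda>u. (norm (h u))\<^sup>2 * (norm (h u) powr r / ((norm (h u))\<^sup>2 + e)))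
      \<le> l powr r * I + (r - 1) * J" if e: "e > 0" for e
  proof -
    define q where "q = (\<lambda>u. norm (h u) powr r / ((norm (h u))\<^sup>2 + e))"
    have pos: "(norm (h u))\<^sup>2 + e > 0" for u using e by (simp add: add_nonneg_pos)
    have q0: "q u \<ge> 0" for u using pos[of u] by (simp add: q_def)
    \<comment> \<open>A continuous substitute for the extremal kernel \<open>cnj h |h|^(r - 2)\<close>, which is singular
       at the zeros of \<open>h\<close> when \<open>r < 2\<close>. Young's inequality, used pointwise, replaces Hoelder's.\<close>
    define \<phi> where "\<phi> = (\<lambda>u. cnj (h u) * of_real (q u))"
    have contq [continuous_intros]: "continuous_on B q" for B
      unfolding q_def using pos by (intro continuous_intros) (metis less_irrefl)
    have cont\<phi> [continuous_intros]: "continuous_on B \<phi>" for B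
      unfolding \<phi>_def by (intro continuous_intros)
    have \<phi>_le: "norm (\<phi> u) \<le> norm (h u) powr (r - 1)" for u
    proof (cases "h u = 0")
      case False
      have "norm (\<phi> u) = norm (h u) * q u"
        using q0[of u] by (simp add: \<phi>_def norm_mult)
      also have "\<dots> = (norm (h u))\<^sup>2 * norm (h u) powr (r - 1) / ((norm (h u))\<^sup>2 + e)"
        using False by (simp add: q_def powr_diff power2_eq_square)
      also have "\<dots> \<le> norm (h u) powr (r - 1)"
        using pos[of u] e by (simp add: divide_le_eq algebra_simps)
      finally show ?thesis .
    qed (simp add: \<phi>_def)
    define G where "G = (\<lambda>z. integral {-A..A} (\<lambda>u. g (z + of_real u) * \<phi> u))"
    have "norm (G (\<i> * of_real y)) \<le> ((l powr r * I + (r - 1) * J) / (r * l)) * exp (s * Im (\<i> * of_real y))"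
    proof (rule phragmen_lindelof_half_plane)
      show "G holomorphic_on UNIV"
        unfolding G_def by (intro holomorphic_convolution g continuous_intros)
      show "\<exists>C. \<forall>z. norm (G z) \<le> C * exp ((s + e) * norm z)" if e: "e > 0" for e
      proof -
        obtain C where C: "\<And>z. norm (g z) \<le> C * exp ((s + e) * norm z)" using growth[OF e] by blast
        have C0: "C \<ge> 0" using order_trans[OF norm_ge_zero C[of 0]] by simp
        \<comment> \<open>A shift by |u| <= A costs only the constant factor exp((s + e) A), so
          \<open>G\<close> inherits the growth bound of \<open>g\<close>.\<close>
        have "norm (G z) \<le> (C * exp ((s + e) * A) * integral {-A..A} (\<lambda>u. norm (\<phi> u))) * exp ((s + e) * norm z)" for z
        proof -
          have "norm (G z) \<le> integral {-A..A} (\<lambda>u. C * exp ((s + e) * (norm z + A)) * norm (\<phi> u))"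
            unfolding G_def
          proof (intro integral_norm_bound_integral integrable_continuous_interval continuous_intros)
            fix u assume u: "u \<in> {-A..A}"
            have "norm (z + of_real u) \<le> norm z + A"
              using norm_triangle_ineq[of z "of_real u"] u by auto
            hence "exp ((s + e) * norm (z + of_real u)) \<le> exp ((s + e) * (norm z + A))"
              using s e by (simp add: mult_left_mono)
            hence "norm (g (z + of_real u)) \<le> C * exp ((s + e) * (norm z + A))"
              using C[of "z + of_real u"] C0 by (meson mult_left_mono order_trans)
            thus "norm (g (z + of_real u) * \<phi> u) \<le> C * exp ((s + e) * (norm z + A)) * norm (\<phi> u)"
              unfolding norm_mult by (intro mult_right_mono) auto
          qed
          also have "\<dots> = (C * exp ((s + e) * A) * integral {-A..A} (\<lambda>u. norm (\<phi> u))) * exp ((s + e) * norm z)"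
            by (simp add: distrib_left exp_add mult_ac)
          finally show ?thesis .
        qed
        thus ?thesis by blast
      qed
      show "norm (G (of_real x)) \<le> (l powr r * I + (r - 1) * J) / (r * l)" for x
      proof -
        let ?g = "\<lambda>u. norm (g (of_real x + of_real u))"
        have "(\<lambda>u. (l powr r * ?g u powr r + (r - 1) * norm (h u) powr r) / (r * l)) integrable_on {-A..A}"
          using r l by (intro integrable_continuous_interval continuous_intros) auto
        hence "norm (G (of_real x)) \<le> integral {-A..A} (\<lambda>u. (l powr r * ?g u powr r + (r - 1) * norm (h u) powr r) / (r * l))"
          unfolding G_def
        proof (rule integral_norm_bound_integral[rotated])
          show "(\<lambda>u. g (of_real x + of_real u) * \<phi> u) integrable_on {-A..A}"
            by (intro integrable_continuous_interval continuous_intros)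
          fix u
          have "(r * l) * norm (g (of_real x + of_real u) * \<phi> u) = r * ((l * ?g u) * norm (\<phi> u))"
            by (simp add: norm_mult)
          also have "\<dots> \<le> r * ((l * ?g u) * norm (h u) powr (r - 1))"
            using r l \<phi>_le by (intro mult_left_mono) auto
          also have "\<dots> \<le> (l * ?g u) powr r + (r - 1) * norm (h u) powr r"
            using r l by (intro powr_tangent) auto
          also have "(l * ?g u) powr r = l powr r * ?g u powr r" using l by (simp add: powr_mult)
          finally show "norm (g (of_real x + of_real u) * \<phi> u)
              \<le> (l powr r * ?g u powr r + (r - 1) * norm (h u) powr r) / (r * l)"
            using r l by (simp add: le_divide_eq mult_ac)
        qed
        also have "\<dots> = (l powr r * integral {-A..A} (\<lambda>u. ?g u powr r) + (r - 1) * J) / (r * l)"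
          unfolding J_def
          by (simp, subst integral_add) (auto intro!: integrable_continuous_interval continuous_intros)
        also have "\<dots> \<le> (l powr r * I + (r - 1) * J) / (r * l)"
          using gI[of x] r l by (intro divide_right_mono add_right_mono mult_left_mono) auto
        finally show ?thesis .
      qed
    qed (use s y in auto)
    also have "exp (s * Im (\<i> * of_real y)) = l" by (simp add: l_def)
    finally have "norm (G (\<i> * of_real y)) \<le> (l powr r * I + (r - 1) * J) / r" using l r by simp
    moreover have "G (\<i> * of_real y) = integral {-A..A} (\<lambda>u. of_real ((norm (h u))\<^sup>2 * q u))"
    proof -
      have "g (\<i> * of_real y + of_real u) * \<phi> u = of_real ((norm (h u))\<^sup>2 * q u)" for u
      proof -
        have "g (\<i> * of_real y + of_real u) * \<phi> u = (h u * cnj (h u)) * of_real (q u)"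
          by (simp add: \<phi>_def h_def add.commute)
        thus ?thesis by (simp only: complex_norm_square[symmetric] of_real_mult)
      qed
      thus ?thesis by (simp add: G_def)
    qed
    moreover have "\<dots> = of_real (integral {-A..A} (\<lambda>u. (norm (h u))\<^sup>2 * q u))"
      by (rule integral_linear[where h = complex_of_real, unfolded o_def])
         (intro integrable_continuous_interval continuous_intros bounded_linear_of_real)+
    ultimately have "\<bar>integral {-A..A} (\<lambda>u. (norm (h u))\<^sup>2 * q u)\<bar> \<le> (l powr r * I + (r - 1) * J) / r"
      by (metis norm_of_real)
    hence "integral {-A..A} (\<lambda>u. (norm (h u))\<^sup>2 * q u) \<le> (l powr r * I + (r - 1) * J) / r" by linarith
    thus ?thesis using r by (simp add: q_def field_simps)
  qed
  \<comment> \<open>As e -> 0 the factor |h|^2 / (|h|^2 + e) increases to 1 off the zeros of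
    \<open>h\<close>, and |h|^r dominates.\<close>
  have lim: "(\<lambda>n. integral {-A..A} (\<lambda>u. (norm (h u))\<^sup>2 * (norm (h u) powr r / ((norm (h u))\<^sup>2 + inverse (real (Suc n)))))) \<longlonglongrightarrow> J"
    unfolding J_def
  proof (rule dominated_convergence(2))
    have pos: "(norm (h u))\<^sup>2 + inverse (real (Suc n)) > 0" for u n by (simp add: add_nonneg_pos)
    show "(\<lambda>u. (norm (h u))\<^sup>2 * (norm (h u) powr r / ((norm (h u))\<^sup>2 + inverse (real (Suc n))))) integrable_on {-A..A}" for n
      using pos[of _ n] by (intro integrable_continuous_interval continuous_intros) (metis less_irrefl)
    show "(\<lambda>u. norm (h u) powr r) integrable_on {-A..A}"
      by (intro integrable_continuous_interval continuous_intros)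
    show "norm ((norm (h u))\<^sup>2 * (norm (h u) powr r / ((norm (h u))\<^sup>2 + inverse (real (Suc n))))) \<le> norm (h u) powr r" for u n
    proof -
      have "(norm (h u))\<^sup>2 * (norm (h u) powr r / ((norm (h u))\<^sup>2 + inverse (real (Suc n)))) \<le> norm (h u) powr r"
        using pos[of u n] by (simp add: divide_le_eq algebra_simps del: of_nat_Suc)
      thus ?thesis using pos[of u n] by (simp del: of_nat_Suc)
    qed
    show "(\<lambda>n. (norm (h u))\<^sup>2 * (norm (h u) powr r / ((norm (h u))\<^sup>2 + inverse (real (Suc n))))) \<longlonglongrightarrow> norm (h u) powr r" for u
    proof (cases "h u = 0")
      case False
      have "(\<lambda>n. (norm (h u))\<^sup>2 * (norm (h u) powr r / ((norm (h u))\<^sup>2 + inverse (real (Suc n)))))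
         \<longlonglongrightarrow> (norm (h u))\<^sup>2 * (norm (h u) powr r / ((norm (h u))\<^sup>2 + 0))"
        using False by (intro tendsto_intros LIMSEQ_inverse_real_of_nat) auto
      thus ?thesis using False by simp
    qed simp
  qed
  have "r * J \<le> l powr r * I + (r - 1) * J"
  proof (rule tendsto_upperbound[OF tendsto_mult_left[OF lim]])
    show "\<forall>\<^sub>F n in sequentially. r * integral {-A..A} (\<lambda>u. (norm (h u))\<^sup>2 * (norm (h u) powr r / ((norm (h u))\<^sup>2 + inverse (real (Suc n)))))
       \<le> l powr r * I + (r - 1) * J"
      by (intro always_eventually allI main) simp
  qed simp
  hence "J \<le> l powr r * I" by (simp add: algebra_simps)
  thus ?thesis unfolding J_def h_def l(2) .
qed

text \<open>Monotone convergence along [-n, n] passes to the whole line. If the integral on the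
  right is infinite, so is the bound, since the exponential factor is positive.\<close>

lemma plancherel_polya_upper:
  fixes g :: "complex \<Rightarrow> complex"
  assumes g: "g holomorphic_on UNIV"
    and growth: "\<And>e. e > 0 \<Longrightarrow> \<exists>C. \<forall>z. norm (g z) \<le> C * exp ((s + e) * norm z)"
    and s: "s \<ge> 0" and r: "r \<ge> 1" and y: "y \<ge> 0"
  shows "(\<integral>\<^sup>+x. ennreal (norm (g (of_real x + \<i> * of_real y)) powr r) \<partial>lborel)
    \<le> ennreal (exp (r * (s * y))) * (\<integral>\<^sup>+x. ennreal (norm (g (of_real x)) powr r) \<partial>lborel)"
proof (cases "(\<integral>\<^sup>+x. ennreal (norm (g (of_real x)) powr r) \<partial>lborel)" rule: ennreal_cases)
  case (real I)
  have contg: "continuous_on B g" for B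
    using g holomorphic_on_imp_continuous_on holomorphic_on_subset by blast
  have [measurable]: "g \<in> borel_measurable borel"
    by (rule borel_measurable_continuous_onI[OF contg])
  let ?u = "\<lambda>x. norm (g (of_real x + \<i> * of_real y)) powr r"
  have contu: "continuous_on UNIV ?u"
    using r by (intro continuous_on_powr' continuous_intros continuous_on_compose2[OF contg[of UNIV]]) auto
  have SUP: "(SUP n. ennreal (?u x) * indicator {- real n..real n} x) = ennreal (?u x)" for x
  proof (rule antisym)
    show "(SUP n. ennreal (?u x) * indicator {- real n..real n} x) \<le> ennreal (?u x)"
      by (rule SUP_least) (auto simp: indicator_def)
    obtain n where "\<bar>x\<bar> \<le> real n" using real_arch_simple by blast
    hence "x \<in> {- real n..real n}" by auto
    hence "ennreal (?u x) = ennreal (?u x) * indicator {- real n..real n} x" by simp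
    also have "\<dots> \<le> (SUP n. ennreal (?u x) * indicator {- real n..real n} x)" by (rule SUP_upper) simp
    finally show "ennreal (?u x) \<le> (SUP n. ennreal (?u x) * indicator {- real n..real n} x)" .
  qed
  have "(\<integral>\<^sup>+x. ennreal (?u x) \<partial>lborel) = (\<integral>\<^sup>+x. (SUP n. ennreal (?u x) * indicator {- real n..real n} x) \<partial>lborel)"
    by (simp add: SUP)
  also have "\<dots> = (SUP n. \<integral>\<^sup>+x. ennreal (?u x) * indicator {- real n..real n} x \<partial>lborel)"
    by (intro nn_integral_monotone_convergence_SUP) (auto simp: incseq_def le_fun_def indicator_def)
  also have "\<dots> \<le> ennreal (exp (r * (s * y)) * I)"
  proof (rule SUP_least)
    fix n
    have "(\<integral>\<^sup>+x. ennreal (?u x) * indicator {- real n..real n} x \<partial>lborel) = ennreal (integral {- real n..real n} ?u)"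
      by (intro nn_integral_interval_eq_integral contu) auto
    also have "\<dots> \<le> ennreal (exp (r * (s * y)) * I)"
      using real by (intro ennreal_leI plancherel_polya_interval[OF g growth s r y]) auto
    finally show "(\<integral>\<^sup>+x. ennreal (?u x) * indicator {- real n..real n} x \<partial>lborel) \<le> ennreal (exp (r * (s * y)) * I)" .
  qed
  also have "\<dots> = ennreal (exp (r * (s * y))) * ennreal I" using real by (simp add: ennreal_mult)
  finally show ?thesis using real by simp
next
  case top
  thus ?thesis by (simp add: ennreal_mult_top)
qed

text \<open>For y < 0 the upper half-plane result is applied to g(-z); the reflection x -> -x leaves
  both line integrals unchanged.\<close>

lemma plancherel_polya:
  fixes g :: "complex \<Rightarrow> complex"
  assumes g: "g holomorphic_on UNIV"
    and growth: "\<And>e. e > 0 \<Longrightarrow> \<exists>C. \<forall>z. norm (g z) \<le> C * exp ((s + e) * norm z)"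
    and s: "s \<ge> 0" and r: "r \<ge> 1"
  shows "(\<integral>\<^sup>+x. ennreal (norm (g (Complex x y)) powr r) \<partial>lborel)
    \<le> ennreal (exp (r * (s * \<bar>y\<bar>))) * (\<integral>\<^sup>+x. ennreal (norm (g (of_real x)) powr r) \<partial>lborel)"
proof (cases "y \<ge> 0")
  case True
  thus ?thesis using plancherel_polya_upper[OF g growth s r, of y] by (simp add: Complex_eq)
next
  case False
  have contg: "continuous_on B g" for B
    using g holomorphic_on_imp_continuous_on holomorphic_on_subset by blast
  have [measurable]: "g \<in> borel_measurable borel"
    by (rule borel_measurable_continuous_onI[OF contg])
  have refl: "(\<integral>\<^sup>+x. f (- x) \<partial>lborel) = (\<integral>\<^sup>+x. f x \<partial>lborel)"
    if "f \<in> borel_measurable borel" for f :: "real \<Rightarrow> ennreal"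
    using nn_integral_real_affine[OF that, of "-1" 0] by simp
  have "(\<integral>\<^sup>+x. ennreal (norm (g (- (of_real x + \<i> * of_real \<bar>y\<bar>))) powr r) \<partial>lborel)
    \<le> ennreal (exp (r * (s * \<bar>y\<bar>))) * (\<integral>\<^sup>+x. ennreal (norm (g (- of_real x)) powr r) \<partial>lborel)"
  proof (rule plancherel_polya_upper)
    have "g \<circ> uminus holomorphic_on UNIV"
      by (intro holomorphic_on_compose_gen[OF _ g] holomorphic_intros) auto
    thus "(\<lambda>z. g (- z)) holomorphic_on UNIV" by (simp add: o_def)
    show "\<exists>C. \<forall>z. norm (g (- z)) \<le> C * exp ((s + e) * norm z)" if "e > 0" for e
      using growth[OF that] by (metis norm_minus_cancel)
  qed (use s r in auto)
  also have "(\<integral>\<^sup>+x. ennreal (norm (g (- of_real x)) powr r) \<partial>lborel) = (\<integral>\<^sup>+x. ennreal (norm (g (of_real x)) powr r) \<partial>lborel)"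
    using refl[of "\<lambda>x. ennreal (norm (g (of_real x)) powr r)"] by simp
  also have "(\<integral>\<^sup>+x. ennreal (norm (g (- (of_real x + \<i> * of_real \<bar>y\<bar>))) powr r) \<partial>lborel)
    = (\<integral>\<^sup>+x. ennreal (norm (g (Complex (- x) y)) powr r) \<partial>lborel)"
    using False by (simp add: Complex_eq)
  also have "\<dots> = (\<integral>\<^sup>+x. ennreal (norm (g (Complex x y)) powr r) \<partial>lborel)"
    by (rule refl[of "\<lambda>x. ennreal (norm (g (Complex x y)) powr r)"]) (simp add: Complex_eq)
  finally show ?thesis .
qed

section \<open>Sampling in one variable\<close>

lemma integral_exp_abs:
  fixes a b :: real
  assumes a: "a > 0" and b: "b \<ge> 0"
  shows "integral {-b..b} (\<lambda>y. exp (a * \<bar>y\<bar>)) = 2 * (exp (a * b) - 1) / a"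
proof -
  have "((\<lambda>y. exp (a * \<bar>y\<bar>)) has_integral exp (a * b) / a - exp (a * 0) / a) {0..b}"
  proof (rule fundamental_theorem_of_calculus[OF b])
    fix y assume "y \<in> {0..b}"
    hence "exp (a * \<bar>y\<bar>) = exp (a * y)" by simp
    moreover have "((\<lambda>y. exp (a * y) / a) has_field_derivative exp (a * y)) (at y within {0..b})"
      using a by (auto intro!: derivative_eq_intros)
    ultimately show "((\<lambda>y. exp (a * y) / a) has_vector_derivative exp (a * \<bar>y\<bar>)) (at y within {0..b})"
      by (simp only: has_real_derivative_iff_has_vector_derivative)
  qed
  hence pos: "((\<lambda>y. exp (a * \<bar>y\<bar>)) has_integral (exp (a * b) - 1) / a) {0..b}"
    by (simp add: diff_divide_distrib)
  have "((\<lambda>y. exp (a * \<bar>-y\<bar>)) has_integral (exp (a * b) - 1) / a) {-b..0}"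
    using has_integral_reflect_real[THEN iffD2, OF pos] by simp
  hence neg: "((\<lambda>y. exp (a * \<bar>y\<bar>)) has_integral (exp (a * b) - 1) / a) {-b..0}" by simp
  have "((\<lambda>y. exp (a * \<bar>y\<bar>)) has_integral (exp (a * b) - 1) / a + (exp (a * b) - 1) / a) {-b..b}"
    by (rule has_integral_combine[OF _ _ neg pos]) (use b in auto)
  thus ?thesis by (simp add: integral_unique)
qed

text \<open>Finite families and values in [0, infinity] make the estimate usable on every section of
  a function of several variables before anything is known about its integrability.\<close>

lemma separated_sampling_le:
  fixes g :: "complex \<Rightarrow> complex" and t :: "'i \<Rightarrow> real"
  assumes g: "g holomorphic_on UNIV"
    and growth: "\<And>e. e > 0 \<Longrightarrow> \<exists>C. \<forall>z. norm (g z) \<le> C * exp ((s + e) * norm z)"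
    and s: "s > 0" and r: "r \<ge> 1" and d: "d > 0" and A: "finite A"
    and sep: "\<And>n m. n \<in> A \<Longrightarrow> m \<in> A \<Longrightarrow> n \<noteq> m \<Longrightarrow> d \<le> \<bar>t n - t m\<bar>"
  shows "(\<Sum>n\<in>A. ennreal (norm (g (of_real (t n))) powr r))
    \<le> ennreal (8 / (r * pi) * ((exp (r * d * s / 2) - 1) / (s * d\<^sup>2)))
        * (\<integral>\<^sup>+x. ennreal (norm (g (of_real x)) powr r) \<partial>lborel)"
proof -
  \<comment> \<open>Half the separation is the largest radius that guarantees disjoint open
    discs.\<close>
  define \<rho> where "\<rho> = d / 2"
  have rho: "\<rho> > 0" "d = 2 * \<rho>" using d by (auto simp: \<rho>_def)
  let ?I = "\<integral>\<^sup>+x. ennreal (norm (g (of_real x)) powr r) \<partial>lborel"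
  let ?u = "\<lambda>x y. ennreal (norm (g (Complex x y)) powr r)"
  have contg: "continuous_on B g" for B
    using g holomorphic_on_imp_continuous_on holomorphic_on_subset by blast
  have [measurable]: "g \<in> borel_measurable borel"
    by (rule borel_measurable_continuous_onI[OF contg])
  have [measurable]: "ball w \<rho> \<in> sets borel" for w :: complex by simp
  \<comment> \<open>Disjointness of the discs and their containment in the strip are both encoded in
    this one inequality between indicators.\<close>
  have ind: "(\<Sum>n\<in>A. indicator (ball (of_real (t n)) \<rho>) (Complex x y) :: ennreal) \<le> indicator {-\<rho>..\<rho>} y" for x y
  proof (cases "\<exists>n\<in>A. Complex x y \<in> ball (of_real (t n)) \<rho>")
    case True
    then obtain n where n: "n \<in> A" "Complex x y \<in> ball (of_real (t n)) \<rho>" by blast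
    have "\<bar>Im (of_real (t n) - Complex x y)\<bar> < \<rho>"
      using abs_Im_le_cmod[of "of_real (t n) - Complex x y"] n by (simp add: dist_norm)
    hence y: "y \<in> {-\<rho>..\<rho>}" by auto
    have "Complex x y \<notin> ball (of_real (t m)) \<rho>" if m: "m \<in> A - {n}" for m
    proof
      assume "Complex x y \<in> ball (of_real (t m)) \<rho>"
      hence "dist (of_real (t n)) (of_real (t m) :: complex) < \<rho> + \<rho>"
        using n by (intro dist_triangle_less_add[of _ "Complex x y"]) (auto simp: dist_commute)
      moreover have "dist (of_real (t n)) (of_real (t m) :: complex) = \<bar>t n - t m\<bar>"
        by (simp add: dist_norm flip: of_real_diff)
      ultimately show False using sep[of n m] m n rho by auto
    qed
    hence "(\<Sum>m\<in>A - {n}. indicator (ball (of_real (t m)) \<rho>) (Complex x y) :: ennreal) = 0"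
      by (intro sum.neutral) (auto simp: indicator_def)
    thus ?thesis using sum.remove[OF A n(1), of "\<lambda>m. indicator (ball (of_real (t m)) \<rho>) (Complex x y) :: ennreal"] n y
      by (simp add: indicator_def)
  next
    case False
    hence "(\<Sum>n\<in>A. indicator (ball (of_real (t n)) \<rho>) (Complex x y) :: ennreal) = 0"
      by (intro sum.neutral) (auto simp: indicator_def)
    thus ?thesis by simp
  qed
  have rs: "r * s > 0" using r s by simp
  \<comment> \<open>\<open>K\<close> is the integral of exp(r s |y|) over [-\<rho>, \<rho>], that is
    2 (exp(r s \<rho>) - 1) / (r s), divided by the disc area pi \<rho>^2, with \<rho> = d /
    2.\<close>
  define K where "K = 8 / (r * pi) * ((exp (r * d * s / 2) - 1) / (s * d\<^sup>2))"
  have K0: "K \<ge> 0" unfolding K_def using r s d by (intro mult_nonneg_nonneg divide_nonneg_nonneg) auto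
  have K: "2 * (exp (r * s * \<rho>) - 1) / (r * s) = (pi * \<rho>\<^sup>2) * K"
    unfolding K_def rho(2) using r s rho by (simp add: field_simps power2_eq_square)
  have "ennreal (pi * \<rho>\<^sup>2) * (\<Sum>n\<in>A. ennreal (norm (g (of_real (t n))) powr r))
      = (\<Sum>n\<in>A. ennreal (pi * \<rho>\<^sup>2 * norm (g (of_real (t n))) powr r))"
    unfolding sum_distrib_left by (intro sum.cong refl ennreal_mult[symmetric]) auto
  also have "\<dots> \<le> (\<Sum>n\<in>A. \<integral>\<^sup>+y. \<integral>\<^sup>+x. ?u x y * indicator (ball (of_real (t n)) \<rho>) (Complex x y) \<partial>lborel \<partial>lborel)"
    using rho by (intro sum_mono holomorphic_disc_mean_powr g r) auto
  also have "\<dots> = (\<integral>\<^sup>+y. (\<Sum>n\<in>A. \<integral>\<^sup>+x. ?u x y * indicator (ball (of_real (t n)) \<rho>) (Complex x y) \<partial>lborel) \<partial>lborel)"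
    by (rule nn_integral_sum[symmetric]) measurable
  also have "\<dots> = (\<integral>\<^sup>+y. \<integral>\<^sup>+x. (\<Sum>n\<in>A. ?u x y * indicator (ball (of_real (t n)) \<rho>) (Complex x y)) \<partial>lborel \<partial>lborel)"
    by (intro nn_integral_cong nn_integral_sum[symmetric]) measurable
  also have "\<dots> = (\<integral>\<^sup>+y. \<integral>\<^sup>+x. ?u x y * (\<Sum>n\<in>A. indicator (ball (of_real (t n)) \<rho>) (Complex x y)) \<partial>lborel \<partial>lborel)"
    by (simp add: sum_distrib_left)
  also have "\<dots> \<le> (\<integral>\<^sup>+y. \<integral>\<^sup>+x. ?u x y * indicator {-\<rho>..\<rho>} y \<partial>lborel \<partial>lborel)"
    by (intro nn_integral_mono mult_left_mono ind) auto
  also have "\<dots> = (\<integral>\<^sup>+y. (\<integral>\<^sup>+x. ?u x y \<partial>lborel) * indicator {-\<rho>..\<rho>} y \<partial>lborel)"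
    by (simp add: nn_integral_multc)
  also have "\<dots> \<le> (\<integral>\<^sup>+y. (ennreal (exp (r * (s * \<bar>y\<bar>))) * ?I) * indicator {-\<rho>..\<rho>} y \<partial>lborel)"
    using s by (intro nn_integral_mono mult_right_mono plancherel_polya[OF g growth _ r]) auto
  also have "\<dots> = (\<integral>\<^sup>+y. (ennreal (exp (r * s * \<bar>y\<bar>)) * indicator {-\<rho>..\<rho>} y) * ?I \<partial>lborel)"
    by (simp add: mult_ac)
  also have "\<dots> = (\<integral>\<^sup>+y. ennreal (exp (r * s * \<bar>y\<bar>)) * indicator {-\<rho>..\<rho>} y \<partial>lborel) * ?I"
    by (rule nn_integral_multc) measurable
  also have "(\<integral>\<^sup>+y. ennreal (exp (r * s * \<bar>y\<bar>)) * indicator {-\<rho>..\<rho>} y \<partial>lborel)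
      = ennreal (integral {-\<rho>..\<rho>} (\<lambda>y. exp (r * s * \<bar>y\<bar>)))"
    by (intro nn_integral_interval_eq_integral continuous_intros) auto
  also have "\<dots> = ennreal (pi * \<rho>\<^sup>2) * ennreal K"
    using integral_exp_abs[OF rs, of \<rho>] rho K K0 by (simp add: ennreal_mult)
  finally have "ennreal (pi * \<rho>\<^sup>2) * (\<Sum>n\<in>A. ennreal (norm (g (of_real (t n))) powr r))
     \<le> ennreal (pi * \<rho>\<^sup>2) * (ennreal K * ?I)" by (simp add: mult.assoc)
  thus ?thesis unfolding K_def[symmetric] using rho
    by (subst (asm) ennreal_mult_le_mult_iff) auto
qed

section \<open>Sampling in several variables\<close>

lemma borel_measurable_vec_lambda:
  fixes f :: "'n::finite \<Rightarrow> 'a \<Rightarrow> real"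
  assumes "\<And>l. f l \<in> borel_measurable M"
  shows "(\<lambda>x. \<chi> l. f l x) \<in> borel_measurable M"
  unfolding borel_measurable_euclidean_space[where 'c = "real ^ 'n"]
  using assms by (auto simp: Basis_vec_def inner_axis)

text \<open>Lebesgue measure is determined by its values on boxes, which identifies it with the
  image of the product measure under the vector constructor.\<close>

lemma nn_integral_lborel_vec:
  fixes G :: "real ^ 'n \<Rightarrow> ennreal"
  assumes [measurable]: "G \<in> borel_measurable borel"
  shows "(\<integral>\<^sup>+x. G (\<chi> l. x l) \<partial>(\<Pi>\<^sub>M l\<in>UNIV. lborel)) = (\<integral>\<^sup>+x. G x \<partial>lborel)"
proof -
  interpret product_sigma_finite "\<lambda>_::'n. lborel :: real measure" ..
  have [measurable]: "(\<lambda>x. \<chi> l. x l) \<in> (\<Pi>\<^sub>M l\<in>(UNIV::'n set). (lborel :: real measure)) \<rightarrow>\<^sub>M borel"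
    by (rule borel_measurable_vec_lambda) measurable
  have "(lborel :: (real ^ 'n) measure) = distr (\<Pi>\<^sub>M l\<in>UNIV. lborel) borel (\<lambda>x. \<chi> l. x l)"
  proof (rule lborel_eqI)
    fix a b :: "real ^ 'n"
    assume ab: "\<And>i. i \<in> Basis \<Longrightarrow> a \<bullet> i \<le> b \<bullet> i"
    have ab': "a $ l \<le> b $ l" for l
    proof -
      have "axis l 1 \<in> (Basis :: (real ^ 'n) set)" by (auto simp: Basis_vec_def)
      thus ?thesis using ab[of "axis l 1"] by (simp add: inner_axis)
    qed
    have "(\<lambda>x. \<chi> l. x l) -` box a b \<inter> space (\<Pi>\<^sub>M l\<in>(UNIV::'n set). (lborel :: real measure))
        = (\<Pi>\<^sub>E l\<in>UNIV. {a $ l <..< b $ l})"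
      by (auto simp: space_PiM mem_box_cart PiE_def Pi_def)
    hence "emeasure (distr (\<Pi>\<^sub>M l\<in>UNIV. lborel) borel (\<lambda>x. \<chi> l. x l)) (box a b)
        = (\<Prod>l\<in>UNIV. ennreal (b $ l - a $ l))"
      using ab' by (simp add: emeasure_distr emeasure_PiM)
    also have "\<dots> = ennreal (\<Prod>l\<in>UNIV. b $ l - a $ l)"
      using ab' by (intro prod_ennreal) auto
    also have "(\<Prod>l\<in>UNIV. b $ l - a $ l) = (\<Prod>i\<in>Basis. (b - a) \<bullet> i)"
    proof -
      have Basis: "(Basis :: (real ^ 'n) set) = range (\<lambda>l. axis l 1)" by (auto simp: Basis_vec_def)
      have "inj (\<lambda>l::'n. axis l (1::real))" by (auto simp: inj_on_def axis_eq_axis)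
      thus ?thesis unfolding Basis by (subst prod.reindex) (simp_all add: inner_axis)
    qed
    finally show "emeasure (distr (\<Pi>\<^sub>M l\<in>UNIV. lborel) borel (\<lambda>x. \<chi> l. x l)) (box a b)
        = (\<Prod>i\<in>Basis. (b - a) \<bullet> i)" .
  qed simp
  hence "(\<integral>\<^sup>+x. G x \<partial>lborel) = (\<integral>\<^sup>+x. G x \<partial>distr (\<Pi>\<^sub>M l\<in>UNIV. lborel) borel (\<lambda>x. \<chi> l. x l))"
    by simp
  also have "\<dots> = (\<integral>\<^sup>+x. G (\<chi> l. x l) \<partial>(\<Pi>\<^sub>M l\<in>UNIV. lborel))"
    by (rule nn_integral_distr) measurable
  finally show ?thesis by simp
qed

lemma sum_PiE_le_nn_integral_PiM:
  fixes G :: "real ^ 'n \<Rightarrow> ennreal" and t :: "'n \<Rightarrow> 'i \<Rightarrow> real"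
  assumes G[measurable]: "G \<in> borel_measurable borel"
    and step: "\<And>i y. (\<Sum>m\<in>A i. G (\<chi> l. if l = i then t i m else y l))
        \<le> K i * (\<integral>\<^sup>+s. G (\<chi> l. if l = i then s else y l) \<partial>lborel)"
    and "finite I"
  shows "(\<Sum>n\<in>Pi\<^sub>E I A. G (\<chi> l. if l \<in> I then t l (n l) else y l))
    \<le> (\<Prod>l\<in>I. K l) * (\<integral>\<^sup>+x. G (\<chi> l. if l \<in> I then x l else y l) \<partial>(\<Pi>\<^sub>M l\<in>I. lborel))"
  using \<open>finite I\<close>
proof (induction I arbitrary: y rule: finite_induct)
  case empty
  interpret product_sigma_finite "\<lambda>_::'n. lborel :: real measure" ..
  show ?case by (subst nn_integral_empty) auto
next
  case (insert i I)
  interpret product_sigma_finite "\<lambda>_::'n. lborel :: real measure" ..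
  let ?P = "\<Pi>\<^sub>M l\<in>I. (lborel :: real measure)"
  have meas [measurable]: "(\<lambda>x. \<chi> l. if l \<in> J then x l else y l) \<in> (\<Pi>\<^sub>M l\<in>J. (lborel :: real measure)) \<rightarrow>\<^sub>M borel" for J :: "'n set" and y
  proof (rule borel_measurable_vec_lambda)
    fix l show "(\<lambda>x. if l \<in> J then x l else y l) \<in> borel_measurable (\<Pi>\<^sub>M l\<in>J. (lborel :: real measure))"
      by (cases "l \<in> J") (simp_all add: measurable_component_singleton[of _ _ "\<lambda>_. lborel :: real measure", simplified])
  qed
  have upd: "(\<chi> l. if l \<in> insert i I then t l ((n(i := m)) l) else y l)
      = (\<chi> l. if l \<in> I then t l (n l) else (y(i := t i m)) l)" for n m
    using insert.hyps by (auto simp: vec_eq_iff)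
  have upd1: "(\<chi> l. if l \<in> I then x l else (y(i := s)) l) = (\<chi> l. if l = i then s else if l \<in> I then x l else y l)"
    for x :: "'n \<Rightarrow> real" and s
    using insert.hyps by (auto simp: vec_eq_iff)
  have upd2: "(\<chi> l. if l \<in> insert i I then (x(i := s)) l else y l) = (\<chi> l. if l = i then s else if l \<in> I then x l else y l)"
    for x :: "'n \<Rightarrow> real" and s
    by (auto simp: vec_eq_iff)
  have "(\<Sum>n\<in>Pi\<^sub>E (insert i I) A. G (\<chi> l. if l \<in> insert i I then t l (n l) else y l))
      = (\<Sum>m\<in>A i. \<Sum>n\<in>Pi\<^sub>E I A. G (\<chi> l. if l \<in> I then t l (n l) else (y(i := t i m)) l))"
    unfolding PiE_insert_eq
    by (subst sum.reindex[OF inj_combinator[OF insert.hyps(2)]])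
       (simp add: o_def split_def upd sum.cartesian_product del: insert_iff fun_upd_apply)
  also have "\<dots> \<le> (\<Sum>m\<in>A i. (\<Prod>l\<in>I. K l) * (\<integral>\<^sup>+x. G (\<chi> l. if l \<in> I then x l else (y(i := t i m)) l) \<partial>?P))"
    by (intro sum_mono insert.IH)
  also have "\<dots> = (\<Prod>l\<in>I. K l) * (\<integral>\<^sup>+x. (\<Sum>m\<in>A i. G (\<chi> l. if l \<in> I then x l else (y(i := t i m)) l)) \<partial>?P)"
    unfolding sum_distrib_left[symmetric] by (subst nn_integral_sum) (auto simp del: fun_upd_apply)
  also have "\<dots> \<le> (\<Prod>l\<in>I. K l) * (\<integral>\<^sup>+x. K i * (\<integral>\<^sup>+s. G (\<chi> l. if l \<in> insert i I then (x(i := s)) l else y l) \<partial>lborel) \<partial>?P)"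
    unfolding upd1 upd2 by (intro mult_left_mono nn_integral_mono step) auto
  also have "\<dots> = (\<Prod>l\<in>I. K l) * (K i * (\<integral>\<^sup>+x. (\<integral>\<^sup>+s. G (\<chi> l. if l \<in> insert i I then (x(i := s)) l else y l) \<partial>lborel) \<partial>?P))"
  proof (subst nn_integral_cmult)
    have [measurable]: "(\<lambda>p. (fst p)(i := snd p)) \<in> ?P \<Otimes>\<^sub>M lborel \<rightarrow>\<^sub>M (\<Pi>\<^sub>M l\<in>insert i I. (lborel :: real measure))"
      by measurable
    show "(\<lambda>x. \<integral>\<^sup>+s. G (\<chi> l. if l \<in> insert i I then (x(i := s)) l else y l) \<partial>lborel) \<in> borel_measurable ?P"
      using measurable_compose[OF \<open>(\<lambda>p. (fst p)(i := snd p)) \<in> _\<close> measurable_compose[OF meas[of "insert i I" y] G]]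
      by (intro lborel.borel_measurable_nn_integral) (simp add: split_def)
  qed simp
  also have "(\<integral>\<^sup>+x. (\<integral>\<^sup>+s. G (\<chi> l. if l \<in> insert i I then (x(i := s)) l else y l) \<partial>lborel) \<partial>?P)
      = (\<integral>\<^sup>+x. G (\<chi> l. if l \<in> insert i I then x l else y l) \<partial>(\<Pi>\<^sub>M l\<in>insert i I. lborel))"
    by (rule product_nn_integral_insert[symmetric, OF insert.hyps]) measurable
  finally show ?case using insert.hyps by (simp add: mult_ac)
qed

section \<open>One-variable sections and the final assembly\<close>

text \<open>The section is \<open>f\<close> along a complex affine line. Complex homogeneity of
  \<open>L\<close> turns the chain-rule derivative into multiplication by
  \<open>L (axis i 1)\<close>, which is complex differentiability.\<close>

lemma entire_fun_section_holomorphic: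
  assumes "entire_fun f"
  shows "(\<lambda>z. f (\<chi> l. if l = i then z else y l)) holomorphic_on UNIV"
  unfolding holomorphic_on_def field_differentiable_def
proof (intro ballI)
  fix z :: complex
  let ?e = "\<lambda>z. \<chi> l. if l = i then z else y l"
  obtain L where L: "(f has_derivative L) (at (?e z))" "\<And>c w. L (c *s w) = c * L w"
    using assms unfolding entire_fun_def by blast
  have "?e = (\<lambda>z. ?e 0 + z *s axis i 1)" by (auto simp: fun_eq_iff vec_eq_iff axis_def)
  moreover have "((\<lambda>z. ?e 0 + z *s axis i 1) has_derivative (\<lambda>h. h *s axis i 1)) (at z)"
  proof -
    have "bounded_linear (\<lambda>z. z *s (axis i 1 :: complex ^ 'a))"
      by (rule bounded_linearI'[where ?f = "\<lambda>z. z *s (axis i 1 :: complex ^ 'a)"])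
         (auto simp: vec_eq_iff algebra_simps)
    thus ?thesis by (auto intro!: derivative_eq_intros bounded_linear_imp_has_derivative)
  qed
  ultimately have "(?e has_derivative (\<lambda>h. h *s axis i 1)) (at z)" by simp
  from has_derivative_compose[OF this L(1)]
  have "((\<lambda>z. f (?e z)) has_derivative (\<lambda>h. h * L (axis i 1))) (at z)" by (simp add: L(2))
  thus "\<exists>f'. ((\<lambda>z. f (?e z)) has_field_derivative f') (at z within UNIV)"
    unfolding has_field_derivative_def by (auto simp: mult.commute[of _ "L (axis i 1)"])
qed

lemma exp_type_le_section:
  assumes "exp_type_le f \<sigma>" and e: "e > 0"
  shows "\<exists>C. \<forall>z. norm (f (\<chi> l. if l = i then z else y l)) \<le> C * exp ((\<sigma> $ i + e) * norm z)"
proof -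
  obtain C where C: "\<And>z. norm (f z) \<le> C * exp (\<Sum>l\<in>UNIV. (\<sigma> $ l + e) * norm (z $ l))"
    using assms unfolding exp_type_le_def by blast
  define B where "B = exp (\<Sum>l\<in>UNIV - {i}. (\<sigma> $ l + e) * norm (y l))"
  have "norm (f (\<chi> l. if l = i then z else y l)) \<le> C * B * exp ((\<sigma> $ i + e) * norm z)" for z
  proof -
    have "(\<Sum>l\<in>UNIV. (\<sigma> $ l + e) * norm ((\<chi> l. if l = i then z else y l) $ l))
      = (\<sigma> $ i + e) * norm z + (\<Sum>l\<in>UNIV - {i}. (\<sigma> $ l + e) * norm (y l))"
      by (subst sum.remove[of _ i]) (auto intro!: sum.cong)
    thus ?thesis using C[of "\<chi> l. if l = i then z else y l"] by (simp add: exp_add B_def mult_ac)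
  qed
  thus ?thesis by blast
qed

theorem theorem1:
  fixes r :: real and \<sigma> \<delta> :: "real ^ 'n" and f :: "complex ^ 'n \<Rightarrow> complex"
    and t :: "'n \<Rightarrow> int \<Rightarrow> real"
  assumes "r \<ge> 1"
    and "\<forall>l. \<sigma> $ l > 0"
    and "f \<in> bernstein_class r \<sigma>"
    and "\<forall>l. \<delta> $ l > 0"
    and "\<forall>l n m. n \<noteq> m \<longrightarrow> \<bar>t l n - t l m\<bar> \<ge> \<delta> $ l"
  shows "(\<lambda>n::int ^ 'n. norm (f (\<chi> l. complex_of_real (t l (n $ l)))) powr r) summable_on UNIV
    \<and> (\<Sum>\<^sub>\<infinity>n::int ^ 'n. norm (f (\<chi> l. complex_of_real (t l (n $ l)))) powr r)
        \<le> (8 / (r * pi)) ^ CARD('n)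
           * (\<Prod>l\<in>UNIV. (exp (r * \<delta> $ l * \<sigma> $ l / 2) - 1) / (\<sigma> $ l * (\<delta> $ l)\<^sup>2))
           * Lr_norm_pow r f"
proof -
  have entire: "entire_fun f" and type: "exp_type_le f \<sigma>" and Lr: "Lr_on_reals r f"
    using assms(3) by (auto simp: bernstein_class_def)
  define G :: "real ^ 'n \<Rightarrow> ennreal" where "G = (\<lambda>x. ennreal (norm (f (cvec_of x)) powr r))"
  \<comment> \<open>The one-variable constant for coordinate \<open>l\<close>; pulling 8 / (r pi)
    out of the product over all \<open>l\<close> yields the power \<open>CARD('n)\<close>.\<close>
  define k where "k = (\<lambda>l. 8 / (r * pi) * ((exp (r * \<delta> $ l * \<sigma> $ l / 2) - 1) / (\<sigma> $ l * (\<delta> $ l)\<^sup>2)))"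
  define F where "F = (\<lambda>n::int ^ 'n. norm (f (\<chi> l. complex_of_real (t l (n $ l)))) powr r)"
  define B where "B = (\<Prod>l\<in>UNIV. k l) * Lr_norm_pow r f"
  have k0: "k l \<ge> 0" for l
    unfolding k_def using assms
    by (intro mult_nonneg_nonneg divide_nonneg_nonneg) (auto simp: less_imp_le)
  have N0: "Lr_norm_pow r f \<ge> 0" unfolding Lr_norm_pow_def by simp
  have G_meas[measurable]: "G \<in> borel_measurable borel"
  proof -
    have [measurable]: "(\<lambda>x. f (cvec_of x)) \<in> borel_measurable borel"
      using Lr by (simp add: Lr_on_reals_def)
    show ?thesis unfolding G_def by measurable
  qed
  have intG: "(\<integral>\<^sup>+x. G x \<partial>lborel) = ennreal (Lr_norm_pow r f)"
    unfolding G_def Lr_norm_pow_def using Lr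
    by (intro nn_integral_eq_integral) (auto simp: Lr_on_reals_def)
  \<comment> \<open>Freezing all coordinates but \<open>i\<close> leaves an entire function of
    exponential type at most \<open>\<sigma> $ i\<close>, to which the one-variable estimate
    applies.\<close>
  have step: "(\<Sum>m\<in>A. G (\<chi> l. if l = i then t i m else y l))
        \<le> ennreal (k i) * (\<integral>\<^sup>+s. G (\<chi> l. if l = i then s else y l) \<partial>lborel)"
    if A: "finite A" for A i y
  proof -
    have *: "G (\<chi> l. if l = i then s else y l)
        = ennreal (norm (f (\<chi> l. if l = i then complex_of_real s else complex_of_real (y l))) powr r)" for s
      unfolding G_def cvec_of_def by (intro arg_cong[where f = "\<lambda>v. ennreal (norm (f v) powr r)"]) (auto simp: vec_eq_iff)
    show ?thesis unfolding * k_def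
      using assms by (intro separated_sampling_le entire_fun_section_holomorphic[OF entire] exp_type_le_section[OF type] A) auto
  qed
  have bound: "sum F S \<le> B" if S: "finite S" for S
  proof -
    \<comment> \<open>The coordinate projections of \<open>S\<close>: their product contains
      \<open>S\<close>, and enlarging to it adds only nonnegative terms and gives the index set a
      product form.\<close>
    define A where "A = (\<lambda>l. (\<lambda>n. n $ l) ` S)"
    have A: "finite (A l)" for l using S by (simp add: A_def)
    have inj: "inj_on (\<lambda>n. \<chi> l. n l) (Pi\<^sub>E UNIV A)"
      by (auto simp: inj_on_def vec_eq_iff)
    have "S \<subseteq> (\<lambda>n. \<chi> l. n l) ` Pi\<^sub>E UNIV A"
    proof
      fix n assume "n \<in> S"
      thus "n \<in> (\<lambda>n. \<chi> l. n l) ` Pi\<^sub>E UNIV A"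
        by (intro image_eqI[of _ _ "\<lambda>l. n $ l"]) (auto simp: A_def vec_eq_iff)
    qed
    hence "sum F S \<le> sum F ((\<lambda>n. \<chi> l. n l) ` Pi\<^sub>E UNIV A)"
      using A by (intro sum_mono2 finite_imageI finite_PiE) (auto simp: F_def)
    also have "\<dots> = (\<Sum>n\<in>Pi\<^sub>E UNIV A. F (\<chi> l. n l))" by (simp add: sum.reindex[OF inj])
    finally have "ennreal (sum F S) \<le> ennreal (\<Sum>n\<in>Pi\<^sub>E UNIV A. F (\<chi> l. n l))" by (rule ennreal_leI)
    also have "\<dots> = (\<Sum>n\<in>Pi\<^sub>E UNIV A. G (\<chi> l. if l \<in> UNIV then t l (n l) else 0))"
      by (subst sum_ennreal[symmetric]) (auto simp: F_def G_def cvec_of_def)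
    also have "\<dots> \<le> (\<Prod>l\<in>UNIV. ennreal (k l)) * (\<integral>\<^sup>+x. G (\<chi> l. if l \<in> UNIV then x l else 0) \<partial>(\<Pi>\<^sub>M l\<in>UNIV. lborel))"
      by (intro sum_PiE_le_nn_integral_PiM step A) auto
    also have "\<dots> = ennreal (\<Prod>l\<in>UNIV. k l) * ennreal (Lr_norm_pow r f)"
      using k0 by (simp add: prod_ennreal nn_integral_lborel_vec intG)
    also have "\<dots> = ennreal B"
      unfolding B_def using k0 N0 by (simp add: ennreal_mult prod_nonneg)
    finally show "sum F S \<le> B"
      using k0 N0 by (subst (asm) ennreal_le_iff) (auto simp: B_def intro!: mult_nonneg_nonneg prod_nonneg)
  qed
  \<comment> \<open>For nonnegative terms a common bound on the finite partial sums gives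
    summability and passes to the infinite sum.\<close>
  have summ: "F summable_on UNIV"
    by (rule nonneg_bdd_above_summable_on) (auto simp: F_def[symmetric] intro!: bdd_aboveI2 bound, simp add: F_def)
  moreover have "infsum F UNIV \<le> B"
    by (rule infsum_le_finite_sums[OF summ bound])
  moreover have "B = (8 / (r * pi)) ^ CARD('n)
           * (\<Prod>l\<in>UNIV. (exp (r * \<delta> $ l * \<sigma> $ l / 2) - 1) / (\<sigma> $ l * (\<delta> $ l)\<^sup>2)) * Lr_norm_pow r f"
    unfolding B_def k_def by (simp only: prod.distrib prod_constant)
  ultimately show ?thesis unfolding F_def by simp
qed

end
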